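(* Let $\mathbb{I}$ be an inertia tensor with $I_{12}=0$, and consider the reduced (Euler-Poincaré-Suslov) equations $$\dot M_1=-\frac{M_2}{I_{11}I_{22}^2}\left(I_{13}I_{22}M_1+I_{11}I_{23}M_2\right),\qquad \dot M_2=\frac{M_1}{I_{22}I_{11}^2}\left(I_{13}I_{22}M_1+I_{11}I_{23}M_2\right).$$ Then the local truncation error of the approximation of the flow of these equations by the projection of the discrete time momentum mapping $\mathcal{B}^*_{(1,\varepsilon)}$ onto the $M_1$-$M_2$ plane is second order. That is, for $(M_1,M_2)$ in a neighbourhood of $(0,0)$, if $(M_1(t),M_2(t))$ denotes the solution of the Euler-Poincaré-Suslov equations $\dot M_1=-\frac{M_2}{I_{11}I_{22}^2}\left(I_{13}I_{22}M_1+I_{11}I_{23}M_2\right)$, $\dot M_2=\frac{M_1}{I_{22}I_{11}^2}\left(I_{13}I_{22}M_1+I_{11}I_{23}M_2\right)$ with initial condition $(M_1(0),M_2(0))=(M_1,M_2)$, and $(\tilde M_1,\tilde M_2)$ denotes the image of $(M_1,M_2)$ under the projection of $\mathcal{B}^*_{(1,\varepsilon)}$ onto the $M_1$-$M_2$ plane, then $$\tilde M_i=M_i(\varepsilon)+\mathcal{O}(\varepsilon^3)\quad\text{as }\varepsilon\to0,\qquad i=1,2.$$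
   Context: The inertia tensor $\mathbb{I}$ is a symmetric positive definite $3\times 3$ real matrix with entries $I_{ij}$ and $I_{12}=0$. Set $$\mathbb{J}=\begin{pmatrix}\frac12(I_{22}+I_{33}-I_{11})&0&-I_{13}\\0&\frac12(I_{11}+I_{33}-I_{22})&-I_{23}\\-I_{13}&-I_{23}&\frac12(I_{11}+I_{22}-I_{33})\end{pmatrix}.$$ Vectors $\omega\in\mathbb{R}^3$ are identified with skew-symmetric matrices $\widehat\omega\in\mathfrak{so}(3)$ by $\widehat\omega\,x=\omega\times x$, and $\mathfrak{so}(3)^*$ is identified with $\mathfrak{so}(3)$ through $\langle\xi,\eta\rangle=\frac12\mathrm{Trace}(\xi\eta^T)$. The time step is $\varepsilon>0$. Let $\mathfrak{d}=\{\omega\in\mathbb{R}^3:\omega_3=0\}$, let $\mathrm{Cay}_\varepsilon(\omega)=(e+\frac{\varepsilon}{2}\widehat\omega)(e-\frac{\varepsilon}{2}\widehat\omega)^{-1}\in SO(3)$, where $e$ is the identity matrix, and let $\mathcal{S}=\mathrm{Cay}_\varepsilon(\mathfrak{d})$, parametrised by $(u,v)\in\mathbb{R}^2$ via $W=\mathrm{Cay}_\varepsilon(u,v,0)$. The reduced discrete Lagrangian is $\ell_d^{(1,\varepsilon)}(W)=-\frac1\varepsilon\mathrm{Trace}(\mathbb{J}W)$. Its discrete Legendre transformation $\mathbb{F}\ell_d^{(1,\varepsilon)}:SO(3)\to\mathfrak{so}(3)^*$ is defined by $\langle\mathbb{F}\ell_d^{(1,\varepsilon)}(W),\xi\rangle=\frac{d}{ds}\big|_{s=0}\ell_d^{(1,\varepsilon)}(\exp(s\xi)W)$.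 For $W=\mathrm{Cay}_\varepsilon(u,v,0)$ the first two components of $M=\mathbb{F}\ell_d^{(1,\varepsilon)}(W)$ are $$M_1=\frac{2\left(2I_{11}u+\varepsilon v(I_{13}u+I_{23}v)\right)}{4+\varepsilon^2(u^2+v^2)},\qquad M_2=\frac{2\left(2I_{22}v-\varepsilon u(I_{13}u+I_{23}v)\right)}{4+\varepsilon^2(u^2+v^2)}.\qquad( * )$$ The momentum locus is $\mathfrak{u}^{(1)}_\varepsilon=\mathbb{F}\ell_d^{(1,\varepsilon)}(\mathcal{S})$. The discrete Euler-Poincaré-Suslov equations are $M_{k+1}=W_k^TM_kW_k+\lambda_k\widehat{e_3}$ with $e_3=(0,0,1)$, $W_k\in\mathcal{S}$, $M_k=\mathbb{F}\ell_d^{(1,\varepsilon)}(W_k)$, and the multiplier $\lambda_k\in\mathbb{R}$ determined by $M_{k+1}\in\mathfrak{u}^{(1)}_\varepsilon$. In the coordinates $(u,v)$ on $\mathcal{S}$ they are equivalent to $$\frac{4I_{11}u_{k+1}+2\varepsilon v_{k+1}(I_{13}u_{k+1}+I_{23}v_{k+1})}{4+\varepsilon^2(u_{k+1}^2+v_{k+1}^2)}=\frac{4I_{11}u_k-2\varepsilon v_k(I_{13}u_k+I_{23}v_k)}{4+\varepsilon^2(u_k^2+v_k^2)},$$ $$\frac{4I_{22}v_{k+1}-2\varepsilon u_{k+1}(I_{13}u_{k+1}+I_{23}v_{k+1})}{4+\varepsilon^2(u_{k+1}^2+v_{k+1}^2)}=\frac{4I_{22}v_k+2\varepsilon u_k(I_{13}u_k+I_{23}v_k)}{4+\varepsilon^2(u_k^2+v_k^2)}.$$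 This is a multivalued map. For $\varepsilon$ small, $\mathcal{B}_{(1,\varepsilon)}$ denotes the (local, single-valued) branch $(u_k,v_k)\mapsto(u_{k+1},v_{k+1})$ depending smoothly on $(u_k,v_k,\varepsilon)$ and with $(u_{k+1},v_{k+1})\to(u_k,v_k)$ as $\varepsilon\to0$, regarded as a map on $\mathcal{S}$. The discrete time momentum mapping is the locally defined map on $\mathfrak{u}^{(1)}_\varepsilon$ given by $\mathcal{B}^*_{(1,\varepsilon)}=\mathbb{F}\ell_d^{(1,\varepsilon)}\circ\mathcal{B}_{(1,\varepsilon)}\circ(\mathbb{F}\ell_d^{(1,\varepsilon)})^{-1}$. Its projection onto the $M_1$-$M_2$ plane is the map $(M_1,M_2)\mapsto(\tilde M_1,\tilde M_2)$ obtained by inverting $( * )$ (smoothly, by the implicit function theorem, near $(M_1,M_2)=(0,0)$ and for small $\varepsilon$, with $(u,v)\to(M_1/I_{11},M_2/I_{22})$ as $\varepsilon\to 0$), applying $\mathcal{B}_{(1,\varepsilon)}$, and evaluating $( * )$ at the result. The local truncation error is second order if, after one step of size $\varepsilon$ from the same initial point, the expansions of the discrete map and of the continuous flow in powers of $\varepsilon$ agree up to and including the terms in $\varepsilon^2$. *)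

theory Defs
  imports "HOL-Analysis.Analysis" "HOL-Library.Landau_Symbols"
begin

text \<open>The set is meant to be open. For such a set \<open>Ck_on k\<close> is the class \<open>C\<^sup>k\<close>, expressed
  by directional derivatives.\<close>

primrec Ck_on :: "nat \<Rightarrow> ('a::real_normed_vector \<Rightarrow> 'b::real_normed_vector) \<Rightarrow> 'a set \<Rightarrow> bool" where
  "Ck_on 0 f S \<longleftrightarrow> continuous_on S f"
| "Ck_on (Suc k) f S \<longleftrightarrow>
     (\<forall>x\<in>S. f differentiable (at x)) \<and> (\<forall>h. Ck_on k (\<lambda>x. frechet_derivative f (at x) h) S)"

definition smooth_on :: "('a::real_normed_vector \<Rightarrow> 'b::real_normed_vector) \<Rightarrow> 'a set \<Rightarrow> bool" where
  "smooth_on f S \<longleftrightarrow> (\<forall>k. Ck_on k f S)"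

definition hat :: "real^3 \<Rightarrow> real^3^3" where
  "hat w = matrix (\<lambda>x. cross3 w x)"

definition so3 :: "(real^3^3) set" where
  "so3 = {A. transpose A = - A}"

definition pairing :: "real^3^3 \<Rightarrow> real^3^3 \<Rightarrow> real" where
  "pairing A B = 1/2 * trace (A ** transpose B)"

text \<open>\<open>exp\<close> and \<open>^\<close> are not available for matrices (the library product \<open>*\<close> on vectors is
  componentwise), hence the explicit power series.\<close>

definition matrix_exp :: "real^3^3 \<Rightarrow> real^3^3" where
  "matrix_exp A = (\<Sum>n. (1 / fact n) *\<^sub>R (((\<lambda>B. A ** B) ^^ n) (mat 1)))"

definition cay :: "real \<Rightarrow> real^3 \<Rightarrow> real^3^3" where
  "cay \<epsilon> w = (mat 1 + (\<epsilon>/2) *\<^sub>R hat w) ** matrix_inv (mat 1 - (\<epsilon>/2) *\<^sub>R hat w)"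

definition inertia_tensor :: "real^3^3 \<Rightarrow> bool" where
  "inertia_tensor I \<longleftrightarrow> transpose I = I \<and> (\<forall>x. x \<noteq> 0 \<longrightarrow> 0 < x \<bullet> (I *v x))"

text \<open>The formula for \<open>J\<close> relies on \<open>I $ 1 $ 2 = 0\<close>; in general \<open>J = (trace I / 2) e - I\<close>.\<close>

definition mass_matrix :: "real^3^3 \<Rightarrow> real^3^3" where
  "mass_matrix I = vector
     [vector [(I$2$2 + I$3$3 - I$1$1) / 2, 0, - I$1$3],
      vector [0, (I$1$1 + I$3$3 - I$2$2) / 2, - I$2$3],
      vector [- I$1$3, - I$2$3, (I$1$1 + I$2$2 - I$3$3) / 2]]"

definition ell_d :: "real^3^3 \<Rightarrow> real \<Rightarrow> real^3^3 \<Rightarrow> real" where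
  "ell_d I \<epsilon> W = - (1/\<epsilon>) * trace (mass_matrix I ** W)"

definition legendre :: "real^3^3 \<Rightarrow> real \<Rightarrow> real^3^3 \<Rightarrow> real^3^3" where
  "legendre I \<epsilon> W = (THE M. M \<in> so3 \<and>
     (\<forall>\<xi>\<in>so3. ((\<lambda>s. ell_d I \<epsilon> (matrix_exp (s *\<^sub>R \<xi>) ** W)) has_real_derivative pairing M \<xi>) (at 0)))"

definition constraint_space :: "(real^3) set" where
  "constraint_space = {w. w$3 = 0}"

definition discrete_constraint :: "real \<Rightarrow> (real^3^3) set" where
  "discrete_constraint \<epsilon> = cay \<epsilon> ` constraint_space"

definition momentum_locus :: "real^3^3 \<Rightarrow> real \<Rightarrow> (real^3^3) set" where
  "momentum_locus I \<epsilon> = legendre I \<epsilon> ` discrete_constraint \<epsilon>"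

text \<open>A relation: the discrete Euler-Poincare-Suslov equations define a multivalued map.\<close>

definition suslov_step :: "real^3^3 \<Rightarrow> real \<Rightarrow> real^3^3 \<Rightarrow> real^3^3 \<Rightarrow> bool" where
  "suslov_step I \<epsilon> W W' \<longleftrightarrow> W \<in> discrete_constraint \<epsilon> \<and> W' \<in> discrete_constraint \<epsilon> \<and>
     (\<exists>l. legendre I \<epsilon> W' = transpose W ** legendre I \<epsilon> W ** W + l *\<^sub>R hat (axis 3 1) \<and>
          transpose W ** legendre I \<epsilon> W ** W + l *\<^sub>R hat (axis 3 1) \<in> momentum_locus I \<epsilon>)"

definition cay_uv :: "real \<Rightarrow> real \<times> real \<Rightarrow> real^3^3" where
  "cay_uv \<epsilon> p = cay \<epsilon> (vector [fst p, snd p, 0])"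

text \<open>The projection to the \<open>M\<^sub>1\<close>-\<open>M\<^sub>2\<close> plane is meant for elements of \<open>so3\<close>, on which \<open>hat\<close>
  has a unique preimage.\<close>

definition proj12 :: "real^3^3 \<Rightarrow> real \<times> real" where
  "proj12 M = (inv hat M $ 1, inv hat M $ 2)"

definition momentum_uv :: "real^3^3 \<Rightarrow> real \<Rightarrow> real \<times> real \<Rightarrow> real \<times> real" where
  "momentum_uv I \<epsilon> p = proj12 (legendre I \<epsilon> (cay_uv \<epsilon> p))"

text \<open>\<open>B \<epsilon>\<close> is, in the coordinates \<open>(u,v)\<close>, the branch of the discrete Suslov map tending to the
  identity as \<open>\<epsilon>\<close> tends to \<open>0\<close>. Its values outside the local domain are irrelevant.\<close>

definition suslov_branch :: "real^3^3 \<Rightarrow> (real \<Rightarrow> real \<times> real \<Rightarrow> real \<times> real) \<Rightarrow> bool" where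
  "suslov_branch I B \<longleftrightarrow> (\<exists>U \<epsilon>0. open U \<and> (0,0) \<in> U \<and> 0 < \<epsilon>0 \<and>
     smooth_on (\<lambda>(\<epsilon>, p). B \<epsilon> p) ({0<..<\<epsilon>0} \<times> U) \<and>
     (\<forall>\<epsilon>\<in>{0<..<\<epsilon>0}. \<forall>p\<in>U. suslov_step I \<epsilon> (cay_uv \<epsilon> p) (cay_uv \<epsilon> (B \<epsilon> p))) \<and>
     (\<forall>p\<in>U. ((\<lambda>\<epsilon>. B \<epsilon> p) \<longlongrightarrow> p) (at_right 0)))"

text \<open>\<open>P \<epsilon>\<close> is the local inverse of \<open>momentum_uv I \<epsilon>\<close> with the prescribed limit.\<close>

definition legendre_inverse :: "real^3^3 \<Rightarrow> (real \<Rightarrow> real \<times> real \<Rightarrow> real \<times> real) \<Rightarrow> bool" where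
  "legendre_inverse I P \<longleftrightarrow> (\<exists>V \<epsilon>0. open V \<and> (0,0) \<in> V \<and> 0 < \<epsilon>0 \<and>
     smooth_on (\<lambda>(\<epsilon>, m). P \<epsilon> m) ({0<..<\<epsilon>0} \<times> V) \<and>
     (\<forall>\<epsilon>\<in>{0<..<\<epsilon>0}. \<forall>m\<in>V. momentum_uv I \<epsilon> (P \<epsilon> m) = m) \<and>
     (\<forall>m\<in>V. ((\<lambda>\<epsilon>. P \<epsilon> m) \<longlongrightarrow> (fst m / I$1$1, snd m / I$2$2)) (at_right 0)))"

definition projected_momentum_map ::
  "real^3^3 \<Rightarrow> (real \<Rightarrow> real \<times> real \<Rightarrow> real \<times> real) \<Rightarrow> (real \<Rightarrow> real \<times> real \<Rightarrow> real \<times> real)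
     \<Rightarrow> real \<Rightarrow> real \<times> real \<Rightarrow> real \<times> real" where
  "projected_momentum_map I B P \<epsilon> = momentum_uv I \<epsilon> \<circ> B \<epsilon> \<circ> P \<epsilon>"

definition reduced_solution ::
  "real^3^3 \<Rightarrow> real \<Rightarrow> (real \<Rightarrow> real) \<Rightarrow> (real \<Rightarrow> real) \<Rightarrow> bool" where
  "reduced_solution I T M1 M2 \<longleftrightarrow> (\<forall>t\<in>{0..T}.
     (M1 has_real_derivative
        - (M2 t / (I$1$1 * (I$2$2)\<^sup>2)) * (I$1$3 * I$2$2 * M1 t + I$1$1 * I$2$3 * M2 t))
       (at t within {0..T}) \<and>
     (M2 has_real_derivative
        M1 t / (I$2$2 * (I$1$1)\<^sup>2) * (I$1$3 * I$2$2 * M1 t + I$1$1 * I$2$3 * M2 t))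
       (at t within {0..T}))"

end

theory Submission
  imports Defs
begin

text \<open>
  In the variable \<open>z = \<epsilon> (u, v)\<close> the step size disappears from the Legendre transformation:
  \<open>momentum_uv I \<epsilon> p = G (\<epsilon> p) / \<epsilon>\<close> for a fixed rational map \<open>G\<close> with invertible derivative at
  \<open>0\<close>. If \<open>H\<close> is its smooth local inverse, then \<open>H (\<epsilon> m) / \<epsilon>\<close> inverts the Legendre transformation.
  As \<open>W\<^sup>T\<close> is the Cayley transform of \<open>- p\<close> when \<open>W\<close> is that of \<open>p\<close>, the discrete equations say that
  \<open>q\<close> follows \<open>p\<close> iff \<open>momentum_uv I \<epsilon> q = - momentum_uv I \<epsilon> (- p)\<close>, so \<open>H (- G (- \<epsilon> p)) / \<epsilon>\<close> is a
  branch of the discrete map. The same identity shows that, for every branch, the projected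
  momentum map sends \<open>m\<close> to \<open>- momentum_uv I \<epsilon> (- P \<epsilon> m)\<close>. It therefore depends on \<open>P\<close> only, and
  expanding the equation \<open>momentum_uv I \<epsilon> (P \<epsilon> m) = m\<close> twice in \<open>\<epsilon>\<close> gives the Taylor polynomial of
  the flow up to order two.
\<close>

section \<open>Calculus of functions of class \<open>C\<^sup>k\<close>\<close>

text \<open>On an open set the two functions agree near every point and so have the same derivatives
  there; the induction hands this agreement on to the directional derivatives.\<close>

lemma Ck_on_cong:
  assumes "open S" "\<And>x. x \<in> S \<Longrightarrow> f x = g x"
  shows "Ck_on k f S \<longleftrightarrow> Ck_on k g S"
  using assms(2)
proof (induction k arbitrary: f g)
  case 0
  then show ?case by (simp cong: continuous_on_cong)
next
  case (Suc k)
  have ev: "\<forall>\<^sub>F y in at x. f y = g y" "f x = g x" if "x \<in> S" for x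
    using Suc.prems assms(1) that eventually_at_topological by blast+
  have "(f has_derivative D) (at x) \<longleftrightarrow> (g has_derivative D) (at x)" if "x \<in> S" for x D
    using has_derivative_transform_eventually[OF _ ev[OF that], of D]
      has_derivative_transform_eventually[of g D x UNIV f] ev[OF that]
    by (metis (mono_tags, lifting) UNIV_I eventually_mono)
  \<comment> \<open>\<open>frechet_derivative\<close> chooses from the set of all derivatives at a
    point. Equal sets give equal choices, so no case distinction on differentiability
    arises.\<close>
  then have D: "f differentiable (at x) \<longleftrightarrow> g differentiable (at x)"
    "frechet_derivative f (at x) = frechet_derivative g (at x)" if "x \<in> S" for x
    using that by (simp_all add: differentiable_def frechet_derivative_def)
  show ?case
    using Suc.IH[of "\<lambda>x. frechet_derivative f (at x) _" "\<lambda>x. frechet_derivative g (at x) _"]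
    by (simp add: D)
qed

text \<open>Replaces the chosen \<open>frechet_derivative\<close> by a derivative \<open>D\<close>
  in closed form. The closure rules below obtain \<open>D\<close> from a differentiation rule and
  then induct on \<open>k\<close>.\<close>

lemma Ck_on_Suc_deriv:
  assumes "open S" "\<And>x. x \<in> S \<Longrightarrow> (f has_derivative D x) (at x)"
  shows "Ck_on (Suc k) f S \<longleftrightarrow> (\<forall>h. Ck_on k (\<lambda>x. D x h) S)"
proof -
  have "D x = frechet_derivative f (at x)" if "x \<in> S" for x
    using assms(2) that frechet_derivative_at by blast
  then show ?thesis
    using assms Ck_on_cong[OF assms(1), of "\<lambda>x. D x _" "\<lambda>x. frechet_derivative f (at x) _"]
    by (auto simp: differentiable_def)
qed

lemma Ck_on_antimono_Suc: "Ck_on (Suc k) f S \<Longrightarrow> Ck_on k f S"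
proof (induction k arbitrary: f)
  case 0
  then show ?case
    by (auto intro!: differentiable_imp_continuous_on
        simp: differentiable_on_def differentiable_at_withinI)
next
  case (Suc k)
  then show ?case by (metis Ck_on.simps(2))
qed

lemma Ck_on_subset: "Ck_on k f S \<Longrightarrow> T \<subseteq> S \<Longrightarrow> Ck_on k f T"
  by (induction k arbitrary: f) (auto intro: continuous_on_subset)

lemma Ck_on_has_derivative:
  "Ck_on (Suc k) f S \<Longrightarrow> x \<in> S \<Longrightarrow> (f has_derivative frechet_derivative f (at x)) (at x)"
  using frechet_derivative_works by auto

lemma Ck_on_const: "open S \<Longrightarrow> Ck_on k (\<lambda>x. c) S"
  by (induction k arbitrary: c) (simp_all add: Ck_on_Suc_deriv[OF _ has_derivative_const] del: Ck_on.simps(2))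

lemma Ck_on_bounded_linear:
  assumes "bounded_linear f" "open S"
  shows "Ck_on k f S"
proof (cases k)
  case 0
  then show ?thesis using assms linear_continuous_on by auto
next
  case (Suc j)
  then show ?thesis
    using assms by (simp add: Ck_on_Suc_deriv[OF _ bounded_linear_imp_has_derivative] Ck_on_const
        del: Ck_on.simps(2))
qed

lemma Ck_on_add:
  assumes "open S" "Ck_on k f S" "Ck_on k g S"
  shows "Ck_on k (\<lambda>x. f x + g x) S"
  using assms(2,3)
proof (induction k arbitrary: f g)
  case 0
  then show ?case by (auto intro: continuous_intros)
next
  case (Suc k)
  have "((\<lambda>x. f x + g x) has_derivative
      (\<lambda>h. frechet_derivative f (at x) h + frechet_derivative g (at x) h)) (at x)" if "x \<in> S" for x
    using Suc.prems that by (intro has_derivative_add Ck_on_has_derivative)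
  then show ?case
    using Suc by (subst Ck_on_Suc_deriv[OF assms(1)]) auto
qed

text \<open>The product rule yields two terms of the same bilinear shape, each pairing a derivative
  with one of the original functions; the latter is of class \<open>k\<close> by
  \<open>Ck_on_antimono_Suc\<close>. Hence the induction varies both functions.\<close>

lemma Ck_on_bounded_bilinear:
  assumes "open S" "bounded_bilinear B" "Ck_on k f S" "Ck_on k g S"
  shows "Ck_on k (\<lambda>x. B (f x) (g x)) S"
  using assms(3,4)
proof (induction k arbitrary: f g)
  case 0
  then show ?case by (auto intro: bounded_bilinear.continuous_on[OF assms(2)])
next
  case (Suc k)
  have "((\<lambda>x. B (f x) (g x)) has_derivative
      (\<lambda>h. B (f x) (frechet_derivative g (at x) h) + B (frechet_derivative f (at x) h) (g x))) (at x)"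
    if "x \<in> S" for x
    using Suc.prems that
    by (intro bounded_bilinear.FDERIV[OF assms(2)] Ck_on_has_derivative)
  moreover have "Ck_on k f S" "Ck_on k g S"
    using Suc.prems Ck_on_antimono_Suc by blast+
  ultimately show ?case
    using Suc by (subst Ck_on_Suc_deriv[OF assms(1)]) (auto intro!: Ck_on_add assms(1))
qed

lemmas Ck_on_mult = Ck_on_bounded_bilinear[OF _ bounded_bilinear_mult]
lemmas Ck_on_scaleR = Ck_on_bounded_bilinear[OF _ bounded_bilinear_scaleR]

lemma Ck_on_minus: "open S \<Longrightarrow> Ck_on k f S \<Longrightarrow> Ck_on k (\<lambda>x. - f x) S"
  using Ck_on_scaleR[OF _ Ck_on_const, of S k f "- 1"] by simp

lemma Ck_on_diff:
  "open S \<Longrightarrow> Ck_on k f S \<Longrightarrow> Ck_on k g S \<Longrightarrow> Ck_on k (\<lambda>x. f x - g x) S"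
  using Ck_on_add[OF _ _ Ck_on_minus] by fastforce

lemma Ck_on_sum:
  assumes "open S" "\<And>i. i \<in> A \<Longrightarrow> Ck_on k (f i) S"
  shows "Ck_on k (\<lambda>x. \<Sum>i\<in>A. f i x) S"
  using assms(2)
  by (induction A rule: infinite_finite_induct) (simp_all add: Ck_on_const Ck_on_add assms(1))

text \<open>The derivative is a product of a derivative of \<open>f\<close> with two copies of the
  reciprocal itself, so the induction keeps \<open>f\<close> fixed and feeds on its own conclusion
  one level lower.\<close>

lemma Ck_on_inverse:
  fixes f :: "'a::real_normed_vector \<Rightarrow> real"
  assumes "open S" "Ck_on k f S" "\<And>x. x \<in> S \<Longrightarrow> f x \<noteq> 0"
  shows "Ck_on k (\<lambda>x. inverse (f x)) S"
  using assms(2)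
proof (induction k)
  case 0
  then show ?case using assms(3) by (auto intro: continuous_intros)
next
  case (Suc k)
  have "((\<lambda>x. inverse (f x)) has_derivative
      (\<lambda>h. - (inverse (f x) * frechet_derivative f (at x) h * inverse (f x)))) (at x)"
    if "x \<in> S" for x
    using Deriv.has_derivative_inverse[OF assms(3)[OF that] Ck_on_has_derivative[OF Suc.prems that]]
    by assumption
  moreover have "Ck_on k (\<lambda>x. inverse (f x)) S"
    using Suc Ck_on_antimono_Suc by blast
  ultimately show ?case
    using Suc.prems
    by (subst Ck_on_Suc_deriv[OF assms(1)]) (auto intro!: Ck_on_minus Ck_on_mult assms(1))
qed

text \<open>\<open>Ck_on\<close> differentiates in a fixed direction, but the chain rule
  differentiates \<open>f\<close> in a direction that moves with \<open>x\<close>. Expanding it in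
  \<open>Basis\<close> leaves fixed directions with scalar coefficients; this is where the middle
  space is Euclidean. Only \<open>f\<close> varies in the induction.\<close>

lemma Ck_on_compose:
  fixes g :: "'a::real_normed_vector \<Rightarrow> 'b::euclidean_space"
  assumes "open S" "open T" "Ck_on k f T" "Ck_on k g S" "g ` S \<subseteq> T"
  shows "Ck_on k (\<lambda>x. f (g x)) S"
  using assms(3,4)
proof (induction k arbitrary: f)
  case 0
  then show ?case using assms(5) by (auto intro: continuous_on_compose2)
next
  case (Suc k)
  have der: "((\<lambda>x. f (g x)) has_derivative
      (\<lambda>h. \<Sum>b\<in>Basis. (frechet_derivative g (at x) h \<bullet> b) *\<^sub>R frechet_derivative f (at (g x)) b)) (at x)"
    if "x \<in> S" for x
  proof -
    have f: "(f has_derivative frechet_derivative f (at (g x))) (at (g x))"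
      using Suc.prems that assms(5) by (auto intro!: Ck_on_has_derivative)
    interpret f: linear "frechet_derivative f (at (g x))"
      using f has_derivative_linear by blast
    have "(\<Sum>b\<in>Basis. (v \<bullet> b) *\<^sub>R frechet_derivative f (at (g x)) b)
        = frechet_derivative f (at (g x)) v" for v
      by (subst euclidean_representation[symmetric, of v]) (simp only: f.sum f.scale)
    then show ?thesis
      using diff_chain_at[OF Ck_on_has_derivative[OF Suc.prems(2) that] f] by (simp add: o_def)
  qed
  have "Ck_on k g S"
    using Suc.prems(2) Ck_on_antimono_Suc by blast
  moreover have "Ck_on k (\<lambda>x. frechet_derivative g (at x) h \<bullet> b) S" for h b
    using Suc.prems(2)
    by (intro Ck_on_bounded_bilinear[OF assms(1) bounded_bilinear_inner] Ck_on_const assms(1)) auto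
  moreover have "Ck_on k (\<lambda>x. frechet_derivative f (at (g x)) b) S" for b
    using Suc.prems(1) \<open>Ck_on k g S\<close> by (intro Suc.IH[of "\<lambda>z. frechet_derivative f (at z) b"]) auto
  ultimately show ?case
    by (subst Ck_on_Suc_deriv[OF assms(1) der]) (auto intro!: Ck_on_sum Ck_on_scaleR assms(1))
qed

lemma Ck_on_Pair:
  assumes "open S" "Ck_on k f S" "Ck_on k g S"
  shows "Ck_on k (\<lambda>x. (f x, g x)) S"
  using assms(2,3)
proof (induction k arbitrary: f g)
  case 0
  then show ?case by (auto intro: continuous_intros)
next
  case (Suc k)
  have "((\<lambda>x. (f x, g x)) has_derivative
      (\<lambda>h. (frechet_derivative f (at x) h, frechet_derivative g (at x) h))) (at x)" if "x \<in> S" for x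
    using Suc.prems that by (intro has_derivative_Pair Ck_on_has_derivative)
  then show ?case
    using Suc by (subst Ck_on_Suc_deriv[OF assms(1)]) auto
qed

section \<open>Linear maps of the plane and smooth local inverses\<close>

lemma linear_plane_eq:
  assumes "linear L"
  shows "L (h :: real \<times> real) = fst h *\<^sub>R L (1, 0) + snd h *\<^sub>R L (0, 1)"
proof -
  have "L h = L (fst h *\<^sub>R (1, 0) + snd h *\<^sub>R (0, 1))"
    by simp
  then show ?thesis
    by (simp only: linear_add[OF assms] linear_scale[OF assms])
qed

definition plane_det :: "(real \<times> real \<Rightarrow> real \<times> real) \<Rightarrow> real" where
  "plane_det L = fst (L (1, 0)) * snd (L (0, 1)) - fst (L (0, 1)) * snd (L (1, 0))"

text \<open>Cramer's rule without division: for regular \<open>L\<close> it shows the inverse as a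
  rational expression in the entries, and for singular \<open>L\<close> it still constrains the
  columns.\<close>

lemma plane_cramer:
  assumes "linear L" "L w = h"
  shows "plane_det L * fst w = snd (L (0, 1)) * fst h - fst (L (0, 1)) * snd h"
    and "plane_det L * snd w = fst (L (1, 0)) * snd h - snd (L (1, 0)) * fst h"
proof -
  have h: "fst h = fst w * fst (L (1, 0)) + snd w * fst (L (0, 1))"
    "snd h = fst w * snd (L (1, 0)) + snd w * snd (L (0, 1))"
    unfolding assms(2)[symmetric] by (subst linear_plane_eq[OF assms(1)], simp)+
  show "plane_det L * fst w = snd (L (0, 1)) * fst h - fst (L (0, 1)) * snd h"
    and "plane_det L * snd w = fst (L (1, 0)) * snd h - snd (L (1, 0)) * fst h"
    unfolding h plane_det_def by algebra+
qed

lemma plane_det_nonzero_iff: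
  assumes "linear L"
  shows "plane_det L \<noteq> 0 \<longleftrightarrow> inj L"
proof
  assume "plane_det L \<noteq> 0"
  then have "w = 0" if "L w = 0" for w
    using plane_cramer[OF assms that] by (simp add: prod_eq_iff)
  then show "inj L"
    by (simp add: linear_injective_0[OF assms])
next
  assume inj: "inj L"
  show "plane_det L \<noteq> 0"
  proof
    \<comment> \<open>With zero determinant, Cramer's rule for preimages of the two basis vectors
      makes the second column vanish, so \<open>(0, 1)\<close> lies in the kernel.\<close>
    assume 0: "plane_det L = 0"
    have "surj L"
      using assms inj by (simp add: linear_injective_imp_surjective)
    from surjD[OF this, of "(1, 0)"] surjD[OF this, of "(0, 1)"]
    obtain v w where "L v = (1, 0)" "L w = (0, 1)"
      by metis
    then have "snd (L (0, 1)) = 0" "fst (L (0, 1)) = 0"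
      using plane_cramer(1)[OF assms, of v] plane_cramer(1)[OF assms, of w] 0 by simp_all
    then have "L (0, 1) = L 0"
      using assms by (simp add: prod_eq_iff linear_0)
    with inj have "(0 :: real, 1 :: real) = 0"
      by (rule injD)
    then show False
      by (simp add: prod_eq_iff)
  qed
qed

text \<open>The inverse function theorem gives a continuous \<open>H\<close> with derivative
  \<open>inv (D (H y))\<close>. Smoothness follows by bootstrapping: by Cramer's rule this
  derivative is rational in the entries of \<open>D (H y)\<close>, so it is of class
  \<open>k\<close> whenever \<open>H\<close> is, and then \<open>H\<close> is of class
  \<open>Suc k\<close>.\<close>

lemma smooth_plane_inverse:
  fixes G :: "real \<times> real \<Rightarrow> real \<times> real"
  assumes "open U" "smooth_on G U" "x0 \<in> U" "inj (frechet_derivative G (at x0))"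
  obtains V H where "open V" "G x0 \<in> V" "smooth_on H V" "H (G x0) = x0"
    "\<And>y. y \<in> V \<Longrightarrow> H y \<in> U \<and> G (H y) = y"
    "\<And>y. y \<in> V \<Longrightarrow> (H has_derivative inv (frechet_derivative G (at (H y)))) (at y)"
proof -
  define D where "D x = frechet_derivative G (at x)" for x
  have Ck: "Ck_on k G U" for k
    using assms(2) by (simp add: smooth_on_def)
  have D: "(G has_derivative D x) (at x)" if "x \<in> U" for x
    using Ck_on_has_derivative[OF Ck that] by (simp add: D_def)
  have lin: "linear (D x)" if "x \<in> U" for x
    using D[OF that] has_derivative_linear by blast
  have CkD: "Ck_on k (\<lambda>x. D x h) U" for k h
    using Ck[of "Suc k"] by (simp add: D_def del: split_paired_All)
  \<comment> \<open>The theorem asks for continuity of the derivative in operator norm; in finite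
    dimension this reduces to continuity of each directional derivative.\<close>
  define D' where "D' x = Blinfun (D x)" for x
  have D': "blinfun_apply (D' x) = D x" if "x \<in> U" for x
    unfolding D'_def using D[OF that] bounded_linear_Blinfun_apply has_derivative_bounded_linear by blast
  have derG: "(G has_derivative blinfun_apply (D' x)) (at x)" if "x \<in> U" for x
    using D D' that by simp
  have contD': "continuous_on U D'"
  proof (rule continuous_on_blinfun_componentwise)
    fix h :: "real \<times> real"
    show "continuous_on U (\<lambda>x. blinfun_apply (D' x) h)"
      using CkD[of 0 h] by (simp add: D' cong: continuous_on_cong)
  qed
  have "bij (D x0)"
    using assms(3,4) lin by (simp add: D_def bij_def linear_injective_imp_surjective)
  then have "linear (inv (D x0))" and inv: "inv (D x0) (D x0 h) = h" for h
    using lin[OF assms(3)] by (simp_all add: bij_def inj_linear_imp_inv_linear)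
  then have "bounded_linear (inv (D x0))"
    using linear_conv_bounded_linear by blast
  then have invf: "Blinfun (inv (D x0)) o\<^sub>L D' x0 = id_blinfun"
    by (intro blinfun_eqI) (simp add: D' assms(3) bounded_linear_Blinfun_apply inv)
  show thesis
  proof (rule inverse_function_theorem[OF assms(1) derG contD' assms(3) invf])
    fix U' V H H'
    assume H: "open U'" "U' \<subseteq> U" "x0 \<in> U'" "open V" "G x0 \<in> V"
      "homeomorphism U' V G H"
      "\<And>y. y \<in> V \<Longrightarrow> (H has_derivative H' y) (at y)"
      "\<And>y. y \<in> V \<Longrightarrow> H' y = inv (blinfun_apply (D' (H y)))"
      "\<And>y. y \<in> V \<Longrightarrow> bij (blinfun_apply (D' (H y)))"
    have HU: "H y \<in> U" "G (H y) = y" if "y \<in> V" for y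
      using H(2,6) that by (auto simp: homeomorphism_def)
    have bij: "bij (D (H y))" if "y \<in> V" for y
      using H(9) that HU D' by metis
    have derH: "(H has_derivative inv (D (H y))) (at y)" if "y \<in> V" for y
      using H(7,8) that HU D' by metis
    define a b c d where "a y = fst (D (H y) (1, 0))" and "b y = fst (D (H y) (0, 1))"
      and "c y = snd (D (H y) (1, 0))" and "d y = snd (D (H y) (0, 1))" for y
    have det: "plane_det (D (H y)) = a y * d y - b y * c y" for y
      by (simp add: plane_det_def a_def b_def c_def d_def)
    have det0: "a y * d y - b y * c y \<noteq> 0" if "y \<in> V" for y
      using plane_det_nonzero_iff[OF lin[OF HU(1)[OF that]]] bij[OF that] det[of y]
      by (simp add: bij_def)
    have "Ck_on k H V" for k
    proof (induction k)
      case 0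
      then show ?case using H(6) by (simp add: homeomorphism_def)
    next
      case (Suc k)
      have comp: "Ck_on k (\<lambda>y. D (H y) h) V" for h
        using Ck_on_compose[OF H(4) assms(1) CkD Suc] HU by blast
      have abcd: "Ck_on k a V" "Ck_on k b V" "Ck_on k c V" "Ck_on k d V"
        unfolding a_def b_def c_def d_def
        using Ck_on_compose[OF H(4) open_UNIV Ck_on_bounded_linear[OF bounded_linear_fst] comp]
          Ck_on_compose[OF H(4) open_UNIV Ck_on_bounded_linear[OF bounded_linear_snd] comp]
        by auto
      define i where "i y = inverse (a y * d y - b y * c y)" for y
      have i: "Ck_on k i V"
        unfolding i_def using det0 abcd
        by (auto intro!: Ck_on_inverse Ck_on_diff Ck_on_mult Ck_on_const H(4))
      have "inv (D (H y)) h = (i y * (d y * fst h - b y * snd h),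
          i y * (a y * snd h - c y * fst h))" if "y \<in> V" for y h
      proof -
        have "D (H y) (inv (D (H y)) h) = h"
          using bij[OF that] by (meson bij_inv_eq_iff)
        from plane_cramer[OF lin[OF HU(1)[OF that]] this, folded a_def b_def c_def d_def, unfolded det]
        show ?thesis
          using det0[OF that] by (simp add: i_def prod_eq_iff field_simps)
      qed
      moreover have "Ck_on k (\<lambda>y. (i y * (d y * fst h - b y * snd h),
          i y * (a y * snd h - c y * fst h))) V" for h :: "real \<times> real"
        using abcd i by (intro Ck_on_Pair Ck_on_mult Ck_on_diff Ck_on_const H(4))
      ultimately have "Ck_on k (\<lambda>y. inv (D (H y)) h) V" for h
        by (subst Ck_on_cong[OF H(4)])
      then show ?case
        by (subst Ck_on_Suc_deriv[OF H(4) derH]) auto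
    qed
    then show thesis
      using that[of V H] H(3-6) HU derH by (auto simp: smooth_on_def D_def homeomorphism_def)
  qed
qed

section \<open>The Legendre transformation on rotation matrices\<close>

lemma matrix_mul_minus_right: "A ** (- B) = - (A ** (B :: 'a::ring_1^'n^'m))"
  by (simp add: matrix_matrix_mult_def vec_eq_iff sum_negf)

lemma matrix_mul_diff_left: "(A - B) ** C = A ** C - B ** (C :: 'a::ring_1^'n^'m)"
  by (simp add: matrix_matrix_mult_def vec_eq_iff sum_subtractf left_diff_distrib)

lemma matrix_mul_diff_right: "A ** (B - C) = A ** B - A ** (C :: 'a::ring_1^'n^'m)"
  by (simp add: matrix_matrix_mult_def vec_eq_iff sum_subtractf right_diff_distrib)

lemma bounded_linear_matrix_mul_left: "bounded_linear (\<lambda>B. A ** (B :: real^'n^'m))"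
  unfolding linear_conv_bounded_linear[symmetric]
  by (rule linearI) (simp_all add: matrix_add_ldistrib matrix_scalar_ac scalar_matrix_assoc)

lemma bounded_linear_matrix_mul_right: "bounded_linear (\<lambda>B :: real^'m^'k. B ** (A :: real^'n^'m))"
  unfolding linear_conv_bounded_linear[symmetric]
  by (rule linearI)
    (simp_all add: matrix_matrix_mult_def vec_eq_iff sum.distrib sum_distrib_left algebra_simps)

lemma bounded_linear_trace: "bounded_linear (trace :: real^'n^'n \<Rightarrow> real)"
  unfolding trace_def linear_conv_bounded_linear[symmetric]
  by (rule linearI) (simp_all add: sum.distrib sum_distrib_left)

section \<open>Matrix exponential and closed form of the Legendre transformation\<close>

lemma trace_transpose: "trace (transpose A) = trace A"
  by (simp add: trace_def transpose_def)

lemma trace_mul_transpose_eq_inner: "trace (A ** transpose B) = A \<bullet> (B :: real^'n^'m)"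
  by (simp add: trace_def matrix_matrix_mult_def transpose_def inner_vec_def)

text \<open>A bounded linear functional turns the exponential series into an everywhere convergent
  real power series in \<open>s\<close>, whose derivative at 0 is its linear coefficient. Scalar
  functionals suffice because \<open>ell_d\<close> is linear in \<open>W\<close>.\<close>

lemma has_derivative_matrix_exp_functional:
  fixes \<phi> :: "real^3^3 \<Rightarrow> real"
  assumes "bounded_linear \<phi>"
  shows "((\<lambda>s. \<phi> (matrix_exp (s *\<^sub>R A))) has_real_derivative \<phi> A) (at 0)"
proof -
  interpret \<phi>: bounded_linear \<phi> by fact
  \<comment> \<open>\<open>P n\<close> is the n-th power of \<open>A\<close>. The bound
    \<open>K\<close> for multiplication by \<open>A\<close> limits it to geometric growth, which the
    factorials beat.\<close>
  define P where "P n = ((\<lambda>B. A ** B) ^^ n) (mat 1)" for n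
  obtain K where K: "0 < K" "\<And>B. norm (A ** B) \<le> norm (B :: real^3^3) * K"
    using bounded_linear.pos_bounded[OF bounded_linear_matrix_mul_left[of A]] by blast
  have P_norm: "norm (P n) \<le> norm (P 0) * K ^ n" for n
  proof (induction n)
    case (Suc n)
    have "norm (P (Suc n)) \<le> norm (P n) * K"
      using K(2) by (simp add: P_def)
    also have "\<dots> \<le> norm (P 0) * K ^ n * K"
      using Suc K(1) by (intro mult_right_mono) auto
    finally show ?case by (simp add: ac_simps)
  qed simp
  have power: "((\<lambda>B. (s *\<^sub>R A) ** B) ^^ n) (mat 1) = s ^ n *\<^sub>R P n" for s n
    by (induction n)
      (simp_all add: P_def matrix_scalar_ac scalar_matrix_assoc[symmetric] mult.commute)
  have summable: "summable (\<lambda>n. (1 / fact n) *\<^sub>R (s ^ n *\<^sub>R P n))" for s :: real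
  proof (rule summable_comparison_test'[of "\<lambda>n. norm (P 0) * (inverse (fact n) * (\<bar>s\<bar> * K) ^ n)" 0])
    show "summable (\<lambda>n. norm (P 0) * (inverse (fact n) * (\<bar>s\<bar> * K) ^ n))"
      by (intro summable_mult summable_exp)
    show "norm ((1 / fact n) *\<^sub>R (s ^ n *\<^sub>R P n)) \<le> norm (P 0) * (inverse (fact n) * (\<bar>s\<bar> * K) ^ n)" for n
      using mult_left_mono[OF P_norm, of "\<bar>s\<bar> ^ n / fact n" n]
      by (simp add: power_abs power_mult_distrib field_simps)
  qed
  define c where "c n = \<phi> (P n) / fact n" for n
  have term_eq: "\<phi> ((1 / fact n) *\<^sub>R (s ^ n *\<^sub>R P n)) = c n * s ^ n" for n s
    by (simp add: c_def \<phi>.scaleR)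
  have "\<phi> (matrix_exp (s *\<^sub>R A)) = (\<Sum>n. c n * s ^ n)" for s
    unfolding matrix_exp_def power \<phi>.suminf[OF summable] term_eq ..
  moreover have "summable (\<lambda>n. c n * s ^ n)" for s
    using \<phi>.summable[OF summable, of s] by (simp only: term_eq)
  then have "((\<lambda>s. \<Sum>n. c n * s ^ n) has_real_derivative (\<Sum>n. diffs c n * 0 ^ n)) (at 0)"
    by (rule termdiffs_strong_converges_everywhere)
  moreover have "diffs c 0 = \<phi> A"
    by (simp add: diffs_def c_def P_def)
  ultimately show ?thesis
    by simp
qed

text \<open>The pairing is half the Frobenius inner product, so testing with the skew matrix
  \<open>M - N\<close> gives norm zero.\<close>

lemma so3_pairing_eqD:
  assumes "M \<in> so3" "N \<in> so3" "\<And>\<xi>. \<xi> \<in> so3 \<Longrightarrow> pairing M \<xi> = pairing N \<xi>"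
  shows "M = N"
proof -
  have "transpose (M - N) = transpose M - transpose N"
    by (simp add: vec_eq_iff transpose_def)
  then have "M - N \<in> so3"
    using assms(1,2) by (simp add: so3_def)
  then have "(M - N) \<bullet> (M - N) = 0"
    using assms(3)[of "M - N"]
    by (simp add: pairing_def trace_mul_transpose_eq_inner inner_diff_left)
  then show ?thesis by simp
qed

lemma transpose_mass_matrix: "transpose (mass_matrix I) = mass_matrix I"
  by (simp add: mass_matrix_def vec_eq_iff forall_3 transpose_def)

lemma skew_part_in_so3:
  "c *\<^sub>R (W ** mass_matrix I - mass_matrix I ** transpose W) \<in> so3"
proof -
  have "mass_matrix I ** transpose W = transpose (W ** mass_matrix I)"
    by (simp add: matrix_transpose_mul transpose_mass_matrix)
  then show ?thesis
    by (simp add: so3_def vec_eq_iff transpose_def algebra_simps)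
qed

text \<open>Cyclicity of the trace, symmetry of \<open>J\<close> and skewness of
  \<open>\<xi>\<close> turn the derivative of the Lagrangian into a pairing with the skew matrix on
  the right; nondegeneracy makes it the only candidate. At \<open>\<epsilon> = 0\<close> both sides
  are 0 by the convention \<open>1 / 0 = 0\<close>.\<close>

lemma legendre_eq:
  "legendre I \<epsilon> W = (1/\<epsilon>) *\<^sub>R (W ** mass_matrix I - mass_matrix I ** transpose W)" (is "_ = ?M")
proof -
  define J where "J = mass_matrix I"
  have deriv: "((\<lambda>s. ell_d I \<epsilon> (matrix_exp (s *\<^sub>R \<xi>) ** W)) has_real_derivative
      - (1/\<epsilon>) * trace (J ** (\<xi> ** W))) (at 0)" for \<xi>
    unfolding ell_d_def J_def
    by (intro has_derivative_matrix_exp_functional bounded_linear_const_mult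
      bounded_linear_compose[OF bounded_linear_trace]
      bounded_linear_compose[OF bounded_linear_matrix_mul_left]
      bounded_linear_matrix_mul_right)
  have pairing: "pairing ?M \<xi> = - (1/\<epsilon>) * trace (J ** (\<xi> ** W))" if "\<xi> \<in> so3" for \<xi>
  proof -
    have \<xi>: "transpose \<xi> = - \<xi>"
      using that by (simp add: so3_def)
    have "(W ** J) \<bullet> \<xi> = - trace (J ** (\<xi> ** W))"
      using trace_mul_sym[of W "J ** \<xi>"]
      by (simp add: trace_mul_transpose_eq_inner[symmetric] \<xi> matrix_mul_minus_right
          matrix_mul_assoc linear_neg[OF bounded_linear.linear[OF bounded_linear_trace]])
    moreover have "(J ** transpose W) \<bullet> \<xi> = trace (J ** (\<xi> ** W))"
    proof -
      have "(J ** transpose W) \<bullet> \<xi> = trace (transpose (\<xi> ** (W ** J)))"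
        by (simp add: trace_mul_transpose_eq_inner[symmetric] matrix_transpose_mul J_def
            transpose_mass_matrix)
      also have "\<dots> = trace (J ** (\<xi> ** W))"
        unfolding trace_transpose by (metis matrix_mul_assoc trace_mul_sym)
      finally show ?thesis .
    qed
    ultimately show ?thesis
      by (simp add: pairing_def trace_mul_transpose_eq_inner inner_diff_left J_def)
  qed
  show ?thesis
    unfolding legendre_def
  proof (rule the_equality)
    show "?M \<in> so3 \<and> (\<forall>\<xi>\<in>so3. ((\<lambda>s. ell_d I \<epsilon> (matrix_exp (s *\<^sub>R \<xi>) ** W))
        has_real_derivative pairing ?M \<xi>) (at 0))"
      using deriv pairing skew_part_in_so3 by simp
  next
    fix M
    assume M: "M \<in> so3 \<and> (\<forall>\<xi>\<in>so3. ((\<lambda>s. ell_d I \<epsilon> (matrix_exp (s *\<^sub>R \<xi>) ** W))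
        has_real_derivative pairing M \<xi>) (at 0))"
    show "M = ?M"
    proof (rule so3_pairing_eqD)
      show "pairing M \<xi> = pairing ?M \<xi>" if "\<xi> \<in> so3" for \<xi>
        unfolding pairing[OF that] using M that deriv by (blast intro: DERIV_unique)
    qed (use M skew_part_in_so3 in auto)
  qed
qed

lemma legendre_in_so3: "legendre I \<epsilon> W \<in> so3"
  unfolding legendre_eq by (rule skew_part_in_so3)

section \<open>Coordinates on \<open>so3\<close>, the Cayley transform and the discrete
  equations\<close>

lemma hat_eq:
  "hat w = vector [vector [0, - w$3, w$2], vector [w$3, 0, - w$1], vector [- w$2, w$1, 0]]"
  unfolding hat_def matrix_def cross3_def axis_def by (simp add: vec_eq_iff forall_3)

lemma inj_hat: "inj hat"
  by (rule injI) (simp add: hat_eq vec_eq_iff forall_3)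

text \<open>Oriented as rewrite rules towards the entries (3,2), (1,3), (2,1), which are the three
  coordinates of the preimage under \<open>hat\<close>.\<close>

lemma so3_components:
  assumes "M \<in> so3"
  shows "M$1$1 = 0" "M$2$2 = 0" "M$3$3 = 0"
    "M$1$2 = - M$2$1" "M$3$1 = - M$1$3" "M$2$3 = - M$3$2"
proof -
  have "M$j$i = - M$i$j" for i j
  proof -
    have "M$j$i = transpose M $ i $ j"
      by (simp add: transpose_def)
    also have "\<dots> = - M$i$j"
      using assms by (simp add: so3_def)
    finally show ?thesis .
  qed
  from this[of 1 1] this[of 2 2] this[of 3 3] this[of 2 1] this[of 1 3] this[of 3 2]
  show "M$1$1 = 0" "M$2$2 = 0" "M$3$3 = 0"
    "M$1$2 = - M$2$1" "M$3$1 = - M$1$3" "M$2$3 = - M$3$2"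
    by linarith+
qed

lemma proj12_so3:
  assumes "M \<in> so3"
  shows "proj12 M = (M$3$2, M$1$3)"
proof -
  have "M = hat (vector [M$3$2, M$1$3, M$2$1])"
    by (simp add: hat_eq vec_eq_iff forall_3 so3_components[OF assms])
  then have "inv hat M = vector [M$3$2, M$1$3, M$2$1]"
    by (metis inj_hat inv_f_f)
  then show ?thesis by (simp add: proj12_def)
qed

text \<open>The Euler-Rodrigues matrix of the quaternion \<open>1 + x i + y j\<close>.\<close>

definition quaternion_matrix :: "real \<Rightarrow> real \<Rightarrow> real^3^3" where
  "quaternion_matrix x y = vector
    [vector [1 + x\<^sup>2 - y\<^sup>2, 2*x*y, 2*y],
     vector [2*x*y, 1 - x\<^sup>2 + y\<^sup>2, - 2*x],
     vector [- 2*y, 2*x, 1 - x\<^sup>2 - y\<^sup>2]]"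

definition planar_rotation :: "real \<Rightarrow> real \<Rightarrow> real^3^3" where
  "planar_rotation x y = (1 / (1 + x\<^sup>2 + y\<^sup>2)) *\<^sub>R quaternion_matrix x y"

lemma matrix_inv_right:
  fixes A :: "'a::semiring_1^'n^'m"
  shows "invertible A \<Longrightarrow> A ** matrix_inv A = mat 1"
  unfolding matrix_inv_def invertible_def by (rule someI2_ex) auto

text \<open>Verified by multiplying the candidate by \<open>mat 1 - A\<close> instead of computing
  an inverse; the determinant \<open>1 + x\<^sup>2 + y\<^sup>2\<close> is positive, so the factor
  can be cancelled.\<close>

lemma cay_uv_eq: "cay_uv \<epsilon> (u, v) = planar_rotation (\<epsilon> * u / 2) (\<epsilon> * v / 2)"
proof -
  define x y where "x = \<epsilon> * u / 2" and "y = \<epsilon> * v / 2"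
  define A where "A = (\<epsilon>/2) *\<^sub>R hat (vector [u, v, 0])"
  have A: "A = vector [vector [0, 0, y], vector [0, 0, - x], vector [- y, x, 0]]"
    by (simp add: A_def hat_eq vec_eq_iff forall_3 x_def y_def)
  have pos: "1 + x\<^sup>2 + y\<^sup>2 > 0"
    by (simp add: add_pos_nonneg)
  have "quaternion_matrix x y ** (mat 1 - A) = (1 + x\<^sup>2 + y\<^sup>2) *\<^sub>R (mat 1 + A)"
    unfolding quaternion_matrix_def A
    by (simp add: vec_eq_iff forall_3 matrix_matrix_mult_def sum_3 mat_def)
      (simp add: algebra_simps power2_eq_square)
  then have eqs: "planar_rotation x y ** (mat 1 - A) = mat 1 + A"
    using pos by (simp add: planar_rotation_def scalar_matrix_assoc[symmetric])
  have "det (mat 1 - A) = 1 + x\<^sup>2 + y\<^sup>2"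
    by (simp add: A det_3 mat_def power2_eq_square)
  then have "invertible (mat 1 - A)"
    using pos by (simp add: invertible_det_nz)
  then have "(mat 1 + A) ** matrix_inv (mat 1 - A) = planar_rotation x y"
    unfolding eqs[symmetric] matrix_mul_assoc[symmetric] by (simp add: matrix_inv_right)
  then show ?thesis
    by (simp add: cay_uv_def cay_def A_def x_def y_def)
qed

lemma planar_rotation_orthogonal: "transpose (planar_rotation x y) ** planar_rotation x y = mat 1"
proof -
  have pos: "1 + x\<^sup>2 + y\<^sup>2 > 0"
    by (simp add: add_pos_nonneg)
  have "transpose (quaternion_matrix x y) ** quaternion_matrix x y
      = ((1 + x\<^sup>2 + y\<^sup>2) * (1 + x\<^sup>2 + y\<^sup>2)) *\<^sub>R mat 1"
    unfolding quaternion_matrix_def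
    by (simp add: vec_eq_iff forall_3 matrix_matrix_mult_def transpose_def sum_3 mat_def)
      (simp add: algebra_simps power2_eq_square)
  then show ?thesis
    using pos by (simp add: planar_rotation_def transpose_scalar scalar_matrix_assoc[symmetric]
        matrix_scalar_ac)
qed

lemma cay_uv_uminus: "cay_uv \<epsilon> (- p) = transpose (cay_uv \<epsilon> p)"
  by (cases p) (simp add: cay_uv_eq planar_rotation_def quaternion_matrix_def vec_eq_iff forall_3 transpose_def)

lemma cay_uv_orthogonal: "transpose (cay_uv \<epsilon> p) ** cay_uv \<epsilon> p = mat 1"
  by (cases p) (simp add: cay_uv_eq planar_rotation_orthogonal)

text \<open>The formula \<open>(*)\<close> in the rescaled variable \<open>z = \<epsilon> (u, v)\<close>, in which the step size drops out.\<close>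

definition scaled_momentum :: "real^3^3 \<Rightarrow> real \<times> real \<Rightarrow> real \<times> real" where
  "scaled_momentum I z =
    ((I$1$1 * fst z + snd z * (I$1$3 * fst z + I$2$3 * snd z) / 2) / (1 + ((fst z)\<^sup>2 + (snd z)\<^sup>2) / 4),
     (I$2$2 * snd z - fst z * (I$1$3 * fst z + I$2$3 * snd z) / 2) / (1 + ((fst z)\<^sup>2 + (snd z)\<^sup>2) / 4))"

text \<open>The two components are the entries (3,2) and (1,3) of
  \<open>W ** J - J ** transpose W\<close>. The halves \<open>x\<close>, \<open>y\<close> are the
  quaternion parameters, and naming the common factor \<open>q\<close> reduces both claims to
  polynomial identities.\<close>

lemma momentum_uv_eq: "momentum_uv I \<epsilon> p = (1/\<epsilon>) *\<^sub>R scaled_momentum I (\<epsilon> *\<^sub>R p)"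
proof -
  obtain u v where p: "p = (u, v)" by fastforce
  define x y where "x = \<epsilon> * u / 2" and "y = \<epsilon> * v / 2"
  have xy: "\<epsilon> * u = 2 * x" "\<epsilon> * v = 2 * y"
    by (simp_all add: x_def y_def)
  define W where "W = planar_rotation x y"
  define J where "J = mass_matrix I"
  define q where "q = 1 / (1 + x\<^sup>2 + y\<^sup>2)"
  have "1 + ((2 * x)\<^sup>2 + (2 * y)\<^sup>2) / 4 = 1 + x\<^sup>2 + y\<^sup>2"
    by (simp add: power2_eq_square)
  then have scaled: "scaled_momentum I (2 * x, 2 * y) =
      (q * (2 * I$1$1 * x + 2 * y * (I$1$3 * x + I$2$3 * y)),
       q * (2 * I$2$2 * y - 2 * x * (I$1$3 * x + I$2$3 * y)))"
    unfolding scaled_momentum_def fst_conv snd_conv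
    by (simp only:) (simp add: q_def algebra_simps add_divide_distrib diff_divide_distrib)
  have "(W ** J - J ** transpose W)$3$2 = fst (scaled_momentum I (2 * x, 2 * y))"
    unfolding scaled W_def J_def planar_rotation_def quaternion_matrix_def q_def[symmetric] mass_matrix_def
    by (simp add: matrix_matrix_mult_def transpose_def sum_3) (simp add: algebra_simps add_divide_distrib diff_divide_distrib power2_eq_square)
  moreover have "(W ** J - J ** transpose W)$1$3 = snd (scaled_momentum I (2 * x, 2 * y))"
    unfolding scaled W_def J_def planar_rotation_def quaternion_matrix_def q_def[symmetric] mass_matrix_def
    by (simp add: matrix_matrix_mult_def transpose_def sum_3) (simp add: algebra_simps add_divide_distrib diff_divide_distrib power2_eq_square)
  ultimately show ?thesis
    unfolding momentum_uv_def proj12_so3[OF legendre_in_so3]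
    by (simp add: legendre_eq p cay_uv_eq xy W_def J_def prod_eq_iff del: vector_minus_component)
qed

text \<open>Orthogonality collapses the transported momentum to
  \<open>(1/\<epsilon>) *\<^sub>R (J ** W - transpose W ** J)\<close>, the negated momentum of
  \<open>transpose W\<close>. The multiplier moves only the third coordinate, so its existence
  amounts to equality of the first two.\<close>

lemma suslov_step_iff:
  "suslov_step I \<epsilon> (cay_uv \<epsilon> p) (cay_uv \<epsilon> q) \<longleftrightarrow> momentum_uv I \<epsilon> q = - momentum_uv I \<epsilon> (- p)"
proof -
  define W J where "W = cay_uv \<epsilon> p" and "J = mass_matrix I"
  have W: "transpose W ** W = mat 1"
    by (simp add: W_def cay_uv_orthogonal)
  have "transpose W ** legendre I \<epsilon> W ** W
      = (1/\<epsilon>) *\<^sub>R ((transpose W ** W) ** J ** W - transpose W ** J ** (transpose W ** W))"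
    by (simp add: legendre_eq J_def matrix_scalar_ac scalar_matrix_assoc[symmetric]
        matrix_mul_diff_left matrix_mul_diff_right matrix_mul_assoc scaleR_diff_right)
  also have "\<dots> = - legendre I \<epsilon> (cay_uv \<epsilon> (- p))"
    by (simp add: legendre_eq cay_uv_uminus W J_def W_def[symmetric] algebra_simps)
  finally have transport: "transpose W ** legendre I \<epsilon> W ** W = - legendre I \<epsilon> (cay_uv \<epsilon> (- p))" .
  have mem: "cay_uv \<epsilon> r \<in> discrete_constraint \<epsilon>" for r
    by (simp add: cay_uv_def discrete_constraint_def constraint_space_def)
  have locus: "legendre I \<epsilon> (cay_uv \<epsilon> q) \<in> momentum_locus I \<epsilon>"
    by (simp add: momentum_locus_def mem)
  \<comment> \<open>Membership in the locus follows from the equation, whose left side is the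
    momentum of \<open>cay_uv \<epsilon> q\<close>.\<close>
  have "suslov_step I \<epsilon> W (cay_uv \<epsilon> q) \<longleftrightarrow>
      (\<exists>l. legendre I \<epsilon> (cay_uv \<epsilon> q) = - legendre I \<epsilon> (cay_uv \<epsilon> (- p)) + l *\<^sub>R hat (axis 3 1))"
    unfolding suslov_step_def transport using mem[of p, folded W_def] mem[of q] locus by metis
  also have "\<dots> \<longleftrightarrow> momentum_uv I \<epsilon> q = - momentum_uv I \<epsilon> (- p)"
  proof -
    have "(\<exists>l. M = - N + l *\<^sub>R hat (axis 3 1)) \<longleftrightarrow> proj12 M = - proj12 N"
      if "M \<in> so3" "N \<in> so3" for M N
    proof -
      \<comment> \<open>Three entries determine a skew matrix, and \<open>l\<close> occurs in one of
        them only, where it can be solved for.\<close>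
      have "M = - N + l *\<^sub>R hat (axis 3 1)
          \<longleftrightarrow> M$3$2 = - N$3$2 \<and> M$1$3 = - N$1$3 \<and> M$2$1 = - N$2$1 + l" for l
        by (simp add: hat_eq vec_eq_iff forall_3 axis_def so3_components that) argo
      moreover have "\<exists>l. M$2$1 = - N$2$1 + l"
        by (rule exI[of _ "M$2$1 + N$2$1"]) simp
      ultimately show ?thesis
        using that by (simp add: proj12_so3)
    qed
    then show ?thesis
      by (simp add: momentum_uv_def legendre_in_so3)
  qed
  finally show ?thesis by (simp add: W_def)
qed

section \<open>Existence of the branch and of the inverse Legendre transformation\<close>

lemma inertia_tensor_diag_pos:
  assumes "inertia_tensor I"
  shows "0 < I$i$i"
proof -
  have "0 < axis i 1 \<bullet> (I *v axis i 1)"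
    using assms by (simp add: inertia_tensor_def axis_eq_0_iff)
  then show ?thesis
    by (simp add: inner_axis' matrix_vector_mult_basis column_def)
qed

lemma scaled_momentum_0 [simp]: "scaled_momentum I 0 = 0"
  by (simp add: scaled_momentum_def zero_prod_def)

lemma smooth_scaled_momentum: "smooth_on (scaled_momentum I) UNIV"
proof -
  \<comment> \<open>Squares become products and quotients become products with
    \<open>inverse\<close>, the shapes handled by the closure rules.\<close>
  have eq: "scaled_momentum I = (\<lambda>z.
      ((I$1$1 * fst z + snd z * (I$1$3 * fst z + I$2$3 * snd z) * (1/2))
          * inverse (1 + (fst z * fst z + snd z * snd z) * (1/4)),
       (I$2$2 * snd z - fst z * (I$1$3 * fst z + I$2$3 * snd z) * (1/2))
          * inverse (1 + (fst z * fst z + snd z * snd z) * (1/4))))"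
    by (simp only: fun_eq_iff scaled_momentum_def divide_inverse power2_eq_square mult_1_left simp_thms)
  have "1 + (fst z * fst z + snd z * snd z) * (1/4) \<noteq> 0" for z :: "real \<times> real"
    by (smt (verit) mult_nonneg_nonneg zero_le_square divide_nonneg_nonneg)
  then show ?thesis
    unfolding eq smooth_on_def
    by (intro allI Ck_on_Pair Ck_on_mult Ck_on_add Ck_on_diff Ck_on_inverse Ck_on_const open_UNIV
        Ck_on_bounded_linear bounded_linear_fst bounded_linear_snd)
qed

text \<open>The numerators are linear up to quadratic terms and the denominator is 1 up to a
  quadratic term, so only the diagonal linear part survives at 0.\<close>

lemma has_derivative_scaled_momentum:
  "(scaled_momentum I has_derivative (\<lambda>z. (I$1$1 * fst z, I$2$2 * snd z))) (at 0)"
proof -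
  define d where "d z = 1 + ((fst z)\<^sup>2 + (snd z)\<^sup>2) / 4" for z :: "real \<times> real"
  define l where "l z = I$1$3 * fst z + I$2$3 * snd z" for z
  have d: "(d has_derivative (\<lambda>z. 0)) (at 0)"
    unfolding d_def by (auto intro!: derivative_eq_intros)
  have l: "(l has_derivative l) (at 0)"
    unfolding l_def by (auto intro!: derivative_eq_intros)
  \<comment> \<open>Both components have this shape; the second takes \<open>- fst z\<close> for
    \<open>g z\<close>.\<close>
  have *: "((\<lambda>z. (c * f z + g z * l z / 2) / d z) has_derivative (\<lambda>z. c * f z)) (at 0)"
    if "(f has_derivative f) (at 0)" "(g has_derivative g) (at 0)" "f 0 = 0" "g 0 = 0" for c f g
    by (rule has_derivative_eq_rhs, rule has_derivative_divide'[OF _ d],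
        (rule derivative_intros that l)+) (auto simp: l_def d_def that)
  have "((\<lambda>z. ((I$1$1 * fst z + snd z * l z / 2) / d z, (I$2$2 * snd z + (- fst z) * l z / 2) / d z))
      has_derivative (\<lambda>z. (I$1$1 * fst z, I$2$2 * snd z))) (at 0)"
    by (intro has_derivative_Pair *) (auto intro!: derivative_eq_intros)
  then show ?thesis
    by (simp add: scaled_momentum_def [abs_def] l_def d_def)
qed

text \<open>The derivative of \<open>H\<close> at 0 is recorded because it determines the limits of
  both rescaled maps as \<open>\<epsilon>\<close> tends to 0.\<close>

lemma scaled_momentum_local_inverse:
  assumes "I$1$1 \<noteq> 0" "I$2$2 \<noteq> 0"
  obtains V H where "open V" "0 \<in> V" "smooth_on H V" "H 0 = 0"
    "\<And>y. y \<in> V \<Longrightarrow> scaled_momentum I (H y) = y"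
    "(H has_derivative (\<lambda>m. (fst m / I$1$1, snd m / I$2$2))) (at 0)"
proof -
  define L where "L z = (I$1$1 * fst z, I$2$2 * snd z)" for z :: "real \<times> real"
  have L: "frechet_derivative (scaled_momentum I) (at 0) = L"
    using frechet_derivative_at[OF has_derivative_scaled_momentum[of I]] by (simp add: L_def[abs_def])
  have "inj L"
    using assms by (intro injI) (simp add: L_def prod_eq_iff)
  obtain V H where H: "open V" "scaled_momentum I 0 \<in> V" "smooth_on H V"
    "H (scaled_momentum I 0) = 0"
    "\<And>y. y \<in> V \<Longrightarrow> H y \<in> UNIV \<and> scaled_momentum I (H y) = y"
    "\<And>y. y \<in> V \<Longrightarrow> (H has_derivative inv (frechet_derivative (scaled_momentum I) (at (H y)))) (at y)"
    using smooth_plane_inverse[OF open_UNIV smooth_scaled_momentum UNIV_I, of I 0]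
      \<open>inj L\<close> L by metis
  have "inv L = (\<lambda>m. (fst m / I$1$1, snd m / I$2$2))"
    by (rule inv_unique_comp) (use assms in \<open>auto simp: L_def fun_eq_iff\<close>)
  then have "(H has_derivative (\<lambda>m. (fst m / I$1$1, snd m / I$2$2))) (at 0)"
    using H(2,4) H(6)[of 0] by (simp add: L)
  with H that show thesis by simp
qed

text \<open>Supplies the limits demanded of \<open>P\<close> and \<open>B\<close>, which are built
  in the form \<open>(1/\<epsilon>) *\<^sub>R f (\<epsilon> *\<^sub>R p)\<close>.\<close>

lemma has_derivative_imp_rescaled_limit:
  assumes "(f has_derivative L) (at 0)" "f 0 = 0"
  shows "((\<lambda>t::real. (1/t) *\<^sub>R f (t *\<^sub>R v)) \<longlongrightarrow> L v) (at_right 0)"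
proof -
  interpret L: bounded_linear L
    using assms(1) by (rule has_derivative_bounded_linear)
  have "((\<lambda>t. f (t *\<^sub>R v)) has_derivative (\<lambda>t. L (t *\<^sub>R v))) (at_right 0)"
    using assms(1) by (intro has_derivative_compose[where f = "\<lambda>t. t *\<^sub>R v" and g = f])
      (auto intro!: derivative_eq_intros)
  then have "((\<lambda>t. norm (f (t *\<^sub>R v) - L (t *\<^sub>R v)) / norm t) \<longlongrightarrow> 0) (at_right 0)"
    using assms(2) by (simp add: has_derivative_iff_norm)
  moreover have "\<forall>\<^sub>F t in at_right 0.
      norm (f (t *\<^sub>R v) - L (t *\<^sub>R v)) / norm t = norm ((1/t) *\<^sub>R f (t *\<^sub>R v) - L v)"
    using eventually_at_right_less
  proof eventually_elim
    case (elim t)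
    have "(1/t) *\<^sub>R f (t *\<^sub>R v) - L v = (1/t) *\<^sub>R (f (t *\<^sub>R v) - L (t *\<^sub>R v))"
      using elim by (simp add: L.scaleR scaleR_diff_right)
    then show ?case using elim by simp
  qed
  ultimately have "((\<lambda>t. norm ((1/t) *\<^sub>R f (t *\<^sub>R v) - L v)) \<longlongrightarrow> 0) (at_right 0)"
    by (rule Lim_transform_eventually)
  then show ?thesis
    using Lim_null tendsto_norm_zero_iff by blast
qed

text \<open>Balls about 0 are star-shaped; this is why the neighbourhoods below are shrunk to balls
  and \<open>\<epsilon>\<close> stays below 1.\<close>

lemma scaleR_in_ball: "p \<in> ball 0 r \<Longrightarrow> \<epsilon> \<in> {0<..<1} \<Longrightarrow> \<epsilon> *\<^sub>R p \<in> ball 0 r"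
  for p :: "'a::real_normed_vector"
  by (auto intro: order_le_less_trans[OF mult_right_mono[of _ 1]])

lemma smooth_rescaled:
  fixes K :: "'a::euclidean_space \<Rightarrow> 'b::real_normed_vector"
  assumes "smooth_on K (ball 0 r)"
  shows "smooth_on (\<lambda>(\<epsilon>, p). (1/\<epsilon>) *\<^sub>R K (\<epsilon> *\<^sub>R p)) ({0<..<1} \<times> ball 0 r)"
proof -
  define S where "S = {0<..<1::real} \<times> ball (0::'a) r"
  have S: "open S" unfolding S_def by (intro open_Times) auto
  have lin: "Ck_on k fst S" "Ck_on k snd S" for k
    using S by (auto intro: Ck_on_bounded_linear bounded_linear_fst bounded_linear_snd)
  have "x \<in> S \<Longrightarrow> fst x *\<^sub>R snd x \<in> ball 0 r" for x
    using scaleR_in_ball[of "snd x" r "fst x"] by (auto simp: S_def)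
  then have "Ck_on k (\<lambda>x. K (fst x *\<^sub>R snd x)) S" for k
    using assms S lin by (intro Ck_on_compose[of S "ball 0 r" k K] Ck_on_scaleR)
      (auto simp: smooth_on_def)
  then have "Ck_on k (\<lambda>x. inverse (fst x) *\<^sub>R K (fst x *\<^sub>R snd x)) S" for k
    using lin S by (intro Ck_on_scaleR Ck_on_inverse) (auto simp: S_def)
  then show ?thesis
    by (simp add: smooth_on_def S_def case_prod_unfold inverse_eq_divide)
qed

lemma legendre_inverse_exists:
  assumes "I$1$1 \<noteq> 0" "I$2$2 \<noteq> 0"
  shows "\<exists>P. legendre_inverse I P"
proof -
  obtain V H where H: "open V" "0 \<in> V" "smooth_on H V" "H 0 = 0"
    "\<And>y. y \<in> V \<Longrightarrow> scaled_momentum I (H y) = y"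
    "(H has_derivative (\<lambda>m. (fst m / I$1$1, snd m / I$2$2))) (at 0)"
    using scaled_momentum_local_inverse[OF assms] by blast
  obtain r where r: "0 < r" "ball 0 r \<subseteq> V"
    using H(1,2) openE by blast
  define P where "P \<epsilon> m = (1/\<epsilon>) *\<^sub>R H (\<epsilon> *\<^sub>R m)" for \<epsilon> :: real and m
  have "smooth_on H (ball 0 r)"
    using H(3) r(2) unfolding smooth_on_def by (blast intro: Ck_on_subset)
  then have "smooth_on (\<lambda>(\<epsilon>, m). P \<epsilon> m) ({0<..<1} \<times> ball 0 r)"
    unfolding P_def by (rule smooth_rescaled)
  moreover have "momentum_uv I \<epsilon> (P \<epsilon> m) = m" if "\<epsilon> \<in> {0<..<1}" "m \<in> ball 0 r" for \<epsilon> m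
  proof -
    have "\<epsilon> *\<^sub>R m \<in> V"
      using scaleR_in_ball[OF that(2,1)] r(2) by blast
    then show ?thesis
      using H(5) that(1) by (simp add: momentum_uv_eq P_def)
  qed
  moreover have "((\<lambda>\<epsilon>. P \<epsilon> m) \<longlongrightarrow> (fst m / I$1$1, snd m / I$2$2)) (at_right 0)" for m
    using has_derivative_imp_rescaled_limit[OF H(6) H(4), of m] by (simp add: P_def)
  ultimately have "legendre_inverse I P"
    unfolding legendre_inverse_def using r(1)
    by (intro exI[of _ "ball 0 r"] exI[of _ 1]) (auto simp: zero_prod_def[symmetric])
  then show ?thesis by blast
qed

lemma suslov_branch_exists:
  assumes "I$1$1 \<noteq> 0" "I$2$2 \<noteq> 0"
  shows "\<exists>B. suslov_branch I B"
proof -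
  obtain V H where H: "open V" "0 \<in> V" "smooth_on H V" "H 0 = 0"
    "\<And>y. y \<in> V \<Longrightarrow> scaled_momentum I (H y) = y"
    "(H has_derivative (\<lambda>m. (fst m / I$1$1, snd m / I$2$2))) (at 0)"
    using scaled_momentum_local_inverse[OF assms] by blast
  \<comment> \<open>In scaled variables the discrete equation reads
    \<open>scaled_momentum I z' = R z\<close>, so \<open>H (R z)\<close> solves it wherever
    \<open>R z\<close> lies in \<open>V\<close>.\<close>
  define R where "R z = - scaled_momentum I (- z)" for z
  have CkR: "Ck_on k R UNIV" for k
  proof -
    have 1: "Ck_on k (scaled_momentum I) UNIV"
      using smooth_scaled_momentum by (simp add: smooth_on_def)
    have 2: "Ck_on k (uminus :: real \<times> real \<Rightarrow> _) UNIV"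
      by (intro Ck_on_bounded_linear bounded_linear_minus bounded_linear_ident open_UNIV)
    show ?thesis
      unfolding R_def
      by (rule Ck_on_minus[OF open_UNIV Ck_on_compose[OF open_UNIV open_UNIV 1 2]]) simp
  qed
  have "open (R -` V)"
    using CkR[of 0] H(1) by (auto intro: continuous_open_vimage simp: continuous_on_eq_continuous_at)
  moreover have "0 \<in> R -` V"
    using H(2) by (simp add: R_def)
  ultimately obtain r where r: "0 < r" "ball 0 r \<subseteq> R -` V"
    using openE by blast
  define K where "K z = H (R z)" for z
  have GK: "scaled_momentum I (K z) = R z" if "z \<in> ball 0 r" for z
    using that r H(5) by (auto simp: K_def)
  define B where "B \<epsilon> p = (1/\<epsilon>) *\<^sub>R K (\<epsilon> *\<^sub>R p)" for \<epsilon> :: real and p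
  have "smooth_on K (ball 0 r)"
    unfolding smooth_on_def K_def
  proof
    fix k
    have "Ck_on k H V"
      using H(3) by (simp add: smooth_on_def)
    moreover have "R ` ball 0 r \<subseteq> V"
      using r(2) by blast
    ultimately show "Ck_on k (\<lambda>z. H (R z)) (ball 0 r)"
      by (intro Ck_on_compose[OF open_ball H(1) _ Ck_on_subset[OF CkR subset_UNIV]])
  qed
  then have "smooth_on (\<lambda>(\<epsilon>, p). B \<epsilon> p) ({0<..<1} \<times> ball 0 r)"
    unfolding B_def by (rule smooth_rescaled)
  moreover have "suslov_step I \<epsilon> (cay_uv \<epsilon> p) (cay_uv \<epsilon> (B \<epsilon> p))"
    if "\<epsilon> \<in> {0<..<1}" "p \<in> ball 0 r" for \<epsilon> p
    using that GK[of "\<epsilon> *\<^sub>R p"] scaleR_in_ball[of p r \<epsilon>]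
    by (auto simp: suslov_step_iff momentum_uv_eq B_def R_def)
  moreover have "((\<lambda>\<epsilon>. B \<epsilon> p) \<longlongrightarrow> p) (at_right 0)" for p
  proof -
    \<comment> \<open>The two sign changes cancel, so \<open>R\<close> has the same derivative at 0
      as \<open>scaled_momentum I\<close>, and \<open>H\<close> inverts it. Thus \<open>K\<close>
      has derivative the identity, which gives the limit \<open>p\<close>.\<close>
    have neg: "(uminus has_derivative uminus) (at (0 :: real \<times> real))"
      by (auto intro!: derivative_eq_intros)
    have "(scaled_momentum I has_derivative (\<lambda>z. (I$1$1 * fst z, I$2$2 * snd z))) (at (- 0))"
      using has_derivative_scaled_momentum by simp
    from has_derivative_minus[OF has_derivative_compose[OF neg this]]
    have "(R has_derivative (\<lambda>z. - (I$1$1 * fst (- z), I$2$2 * snd (- z)))) (at 0)"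
      by (simp add: R_def[abs_def])
    moreover have "(H has_derivative (\<lambda>m. (fst m / I$1$1, snd m / I$2$2))) (at (R 0))"
      using H(6) by (simp add: R_def)
    ultimately have "(K has_derivative (\<lambda>z. z)) (at 0)"
      using has_derivative_compose assms by (fastforce simp: K_def[abs_def])
    moreover have "K 0 = 0"
      by (simp add: K_def R_def H(4))
    ultimately show ?thesis
      unfolding B_def by (rule has_derivative_imp_rescaled_limit)
  qed
  ultimately have "suslov_branch I B"
    unfolding suslov_branch_def using r(1)
    by (intro exI[of _ "ball 0 r"] exI[of _ 1]) (auto simp: zero_prod_def[symmetric])
  then show ?thesis by blast
qed

section \<open>Second order expansions\<close>

lemma Taylor2_bigo:
  fixes f :: "nat \<Rightarrow> real \<Rightarrow> real"
  assumes "0 < T"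
    and f: "\<And>i t. t \<in> {0..T} \<Longrightarrow> i \<le> 2 \<Longrightarrow> (f i has_real_derivative f (Suc i) t) (at t within {0..T})"
    and cont: "continuous_on {0..T} (f 3)"
  shows "(\<lambda>\<epsilon>. f 0 \<epsilon> - (f 0 0 + \<epsilon> * f 1 0 + \<epsilon>\<^sup>2 / 2 * f 2 0)) \<in> O[at_right 0](\<lambda>\<epsilon>. \<epsilon> ^ 3)"
proof -
  have "bounded (f 3 ` {0..T})"
    using cont by (intro compact_imp_bounded compact_continuous_image) auto
  then obtain C where "\<forall>t\<in>{0..T}. norm (f 3 t) \<le> C"
    by (auto simp: bounded_iff)
  then have C: "norm (f (Suc 2) t) \<le> C" if "t \<in> {0..T}" for t
    using that by (simp add: eval_nat_numeral)
  \<comment> \<open>The factor 1/2 instead of 1/6 comes from the remainder in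
    \<open>field_Taylor\<close>, which carries the factorial of 2; the order in
    \<open>\<epsilon>\<close> is the same.\<close>
  have "norm (f 0 \<epsilon> - (f 0 0 + \<epsilon> * f 1 0 + \<epsilon>\<^sup>2 / 2 * f 2 0)) \<le> (C / 2) * norm (\<epsilon> ^ 3)"
    if "0 < \<epsilon>" "\<epsilon> < T" for \<epsilon>
  proof -
    have "norm (f 0 \<epsilon> - (\<Sum>i\<le>2. f i 0 * (\<epsilon> - 0) ^ i / fact i)) \<le> C * norm (\<epsilon> - 0) ^ Suc 2 / fact 2"
      by (rule field_Taylor[OF convex_real_interval(5) f C]) (use that in auto)
    then show ?thesis
      by (simp add: numeral_2_eq_2 power3_eq_cube abs_mult algebra_simps)
  qed
  moreover have "\<forall>\<^sub>F \<epsilon> in at_right 0. 0 < \<epsilon> \<and> \<epsilon> < T"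
    using assms(1) eventually_at_right_field by blast
  ultimately show ?thesis
    by (intro bigoI[of _ "C / 2"]) (auto elim: eventually_mono)
qed

text \<open>\<open>x\<close> and \<open>y\<close> stand for momenta divided by \<open>c1\<close> and
  \<open>c2\<close>. The Taylor polynomial of \<open>c1 * x\<close> is written exactly as the one in
  \<open>step_expansion\<close>, so that the two cancel on subtraction.\<close>

lemma flow_expansion:
  fixes x y :: "real \<Rightarrow> real" and c1 c2 \<alpha> \<beta> :: real
  assumes "0 < T" "c1 \<noteq> 0" "c2 \<noteq> 0"
    and x: "\<And>t. t \<in> {0..T} \<Longrightarrow>
      (x has_real_derivative - (y t * (\<alpha> * x t + \<beta> * y t)) / c1) (at t within {0..T})"
    and y: "\<And>t. t \<in> {0..T} \<Longrightarrow>
      (y has_real_derivative x t * (\<alpha> * x t + \<beta> * y t) / c2) (at t within {0..T})"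
  defines "l \<equiv> \<alpha> * x 0 + \<beta> * y 0"
  shows "(\<lambda>\<epsilon>. c1 * x \<epsilon> - (c1 * x 0 - \<epsilon> * (y 0 * l)
      - \<epsilon>\<^sup>2 / 2 * (x 0 * l / c2 * l + y 0 * (\<alpha> * (- (y 0 * l) / c1) + \<beta> * (x 0 * l / c2)))))
    \<in> O[at_right 0](\<lambda>\<epsilon>. \<epsilon> ^ 3)"
proof -
  \<comment> \<open>The digits 1 and 2 count time derivatives. The equations of motion express each
    of them through \<open>x\<close> and \<open>y\<close> alone, so the third derivative of
    \<open>c1 * x\<close> is continuous.\<close>
  define L where "L t = \<alpha> * x t + \<beta> * y t" for t
  define X1 where "X1 t = - (y t * L t) / c1" for t
  define Y1 where "Y1 t = x t * L t / c2" for t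
  define L1 where "L1 t = \<alpha> * X1 t + \<beta> * Y1 t" for t
  define X2 where "X2 t = - (Y1 t * L t + y t * L1 t) / c1" for t
  define Y2 where "Y2 t = (X1 t * L t + x t * L1 t) / c2" for t
  define L2 where "L2 t = \<alpha> * X2 t + \<beta> * Y2 t" for t
  define f where "f = (\<lambda>i::nat. if i = 0 then (\<lambda>t. c1 * x t) else if i = 1 then (\<lambda>t. - (y t * L t))
    else if i = 2 then (\<lambda>t. - (Y1 t * L t + y t * L1 t))
    else (\<lambda>t. - (Y2 t * L t + 2 * (Y1 t * L1 t) + y t * L2 t)))"
  have x': "(x has_real_derivative X1 t) (at t within {0..T})"
    and y': "(y has_real_derivative Y1 t) (at t within {0..T})" if "t \<in> {0..T}" for t
    using x[OF that] y[OF that] by (simp_all add: X1_def Y1_def L_def)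
  have L': "(L has_real_derivative L1 t) (at t within {0..T})" if "t \<in> {0..T}" for t
    unfolding L_def L1_def by (auto intro!: derivative_eq_intros x' y' that)
  have X1': "(X1 has_real_derivative X2 t) (at t within {0..T})" if "t \<in> {0..T}" for t
    unfolding X1_def X2_def using assms(2)
    by (auto intro!: derivative_eq_intros L' y' that simp: field_simps)
  have Y1': "(Y1 has_real_derivative Y2 t) (at t within {0..T})" if "t \<in> {0..T}" for t
    unfolding Y1_def Y2_def using assms(3)
    by (auto intro!: derivative_eq_intros L' x' that simp: field_simps)
  have L1': "(L1 has_real_derivative L2 t) (at t within {0..T})" if "t \<in> {0..T}" for t
    unfolding L1_def L2_def by (auto intro!: derivative_eq_intros X1' Y1' that)
  have der: "(f i has_real_derivative f (Suc i) t) (at t within {0..T})"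
    if t: "t \<in> {0..T}" and i: "i \<le> 2" for i t
  proof -
    consider "i = 0" | "i = 1" | "i = 2" using i by linarith
    then show ?thesis
    proof cases
      case 1
      then show ?thesis
        using DERIV_cmult[OF x'[OF t], of c1] assms(2) by (simp add: f_def X1_def)
    next
      case 2
      then show ?thesis
        using DERIV_minus[OF DERIV_mult[OF y'[OF t] L'[OF t]]]
        by (simp add: f_def algebra_simps)
    next
      case 3
      then show ?thesis
        using DERIV_minus[OF DERIV_add[OF DERIV_mult[OF Y1'[OF t] L'[OF t]]
              DERIV_mult[OF y'[OF t] L1'[OF t]]]]
        by (simp add: f_def algebra_simps)
    qed
  qed
  have cont: "continuous_on {0..T} x" "continuous_on {0..T} y"
    by (blast intro: DERIV_continuous_on x' y')+
  then have "continuous_on {0..T} (f 3)"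
    using assms(2,3) unfolding f_def L2_def X2_def Y2_def L1_def X1_def Y1_def L_def
    by (auto intro!: continuous_intros)
  from Taylor2_bigo[OF assms(1) der this] show ?thesis
    by (simp add: f_def L1_def X1_def Y1_def L_def l_def algebra_simps)
qed

text \<open>Only limits of \<open>u\<close>, \<open>v\<close> at 0 are given, no derivatives in
  \<open>\<epsilon>\<close>, so the implicit equations are substituted into themselves twice. They
  place \<open>(u, v)\<close> half a time step along the flow to first order; the step then
  evaluates \<open>v * l\<close> there, as in the midpoint rule, which is the source of second order
  accuracy.\<close>

lemma step_expansion:
  fixes u v :: "real \<Rightarrow> real" and c1 c2 \<alpha> \<beta> u0 v0 :: real
  assumes "c1 \<noteq> 0" "c2 \<noteq> 0"
    and u: "(u \<longlongrightarrow> u0) (at_right 0)" and v: "(v \<longlongrightarrow> v0) (at_right 0)"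
  defines "D \<equiv> \<lambda>\<epsilon>. 1 + \<epsilon>\<^sup>2 * ((u \<epsilon>)\<^sup>2 + (v \<epsilon>)\<^sup>2) / 4"
    and "l \<equiv> \<lambda>\<epsilon>. \<alpha> * u \<epsilon> + \<beta> * v \<epsilon>" and "l0 \<equiv> \<alpha> * u0 + \<beta> * v0"
  assumes eq1: "\<forall>\<^sub>F \<epsilon> in at_right 0. (c1 * u \<epsilon> + \<epsilon> * (v \<epsilon> * l \<epsilon>) / 2) / D \<epsilon> = c1 * u0"
    and eq2: "\<forall>\<^sub>F \<epsilon> in at_right 0. (c2 * v \<epsilon> - \<epsilon> * (u \<epsilon> * l \<epsilon>) / 2) / D \<epsilon> = c2 * v0"
  shows "(\<lambda>\<epsilon>. (c1 * u \<epsilon> - \<epsilon> * (v \<epsilon> * l \<epsilon>) / 2) / D \<epsilon> - (c1 * u0 - \<epsilon> * (v0 * l0)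
      - \<epsilon>\<^sup>2 / 2 * (u0 * l0 / c2 * l0 + v0 * (\<alpha> * (- (v0 * l0) / c1) + \<beta> * (u0 * l0 / c2)))))
    \<in> O[at_right 0](\<lambda>\<epsilon>. \<epsilon> ^ 3)"
proof -
  define s where "s \<epsilon> = ((u \<epsilon>)\<^sup>2 + (v \<epsilon>)\<^sup>2) / 4" for \<epsilon>
  \<comment> \<open>These remainders equal difference quotients, but their defining formulas avoid
    division by \<open>\<epsilon>\<close>; hence they converge merely because \<open>u\<close> and
    \<open>v\<close> do.\<close>
  define ru where "ru \<epsilon> = u0 * \<epsilon> * s \<epsilon> - v \<epsilon> * l \<epsilon> / (2 * c1)" for \<epsilon>
  define rv where "rv \<epsilon> = v0 * \<epsilon> * s \<epsilon> + u \<epsilon> * l \<epsilon> / (2 * c2)" for \<epsilon>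
  define rl where "rl \<epsilon> = \<alpha> * ru \<epsilon> + \<beta> * rv \<epsilon>" for \<epsilon>
  define ru2 where "ru2 \<epsilon> = u0 * s \<epsilon> - (rv \<epsilon> * l \<epsilon> + v0 * rl \<epsilon>) / (2 * c1)" for \<epsilon>
  define rv2 where "rv2 \<epsilon> = v0 * s \<epsilon> + (ru \<epsilon> * l \<epsilon> + u0 * rl \<epsilon>) / (2 * c2)" for \<epsilon>
  define R where "R \<epsilon> = s \<epsilon> * v \<epsilon> * l \<epsilon> / D \<epsilon>
    - (rv2 \<epsilon> * l0 + v0 * (\<alpha> * ru2 \<epsilon> + \<beta> * rv2 \<epsilon>) + rv \<epsilon> * rl \<epsilon>)" for \<epsilon>
  have D_pos: "D \<epsilon> > 0" for \<epsilon>
    by (simp add: D_def add_pos_nonneg)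
  have "\<exists>c. (R \<longlongrightarrow> c) (at_right 0)"
  proof -
    have id: "((\<lambda>\<epsilon>::real. \<epsilon>) \<longlongrightarrow> 0) (at_right 0)"
      by (rule tendsto_ident_at)
    have D: "(D \<longlongrightarrow> 1) (at_right 0)"
      unfolding D_def by (rule tendsto_eq_rhs, (rule tendsto_intros u v id | simp)+)
    show ?thesis
      unfolding R_def rv2_def ru2_def rl_def ru_def rv_def s_def l_def
      by (rule exI, (rule tendsto_intros u v id D | use assms(1,2) in simp)+)
  qed
  then obtain c where R: "(R \<longlongrightarrow> c) (at_right 0)" ..
  have eq: "\<forall>\<^sub>F \<epsilon> in at_right 0. (c1 * u \<epsilon> - \<epsilon> * (v \<epsilon> * l \<epsilon>) / 2) / D \<epsilon> - (c1 * u0 - \<epsilon> * (v0 * l0)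
      - \<epsilon>\<^sup>2 / 2 * (u0 * l0 / c2 * l0 + v0 * (\<alpha> * (- (v0 * l0) / c1) + \<beta> * (u0 * l0 / c2))))
      = \<epsilon> ^ 3 * R \<epsilon>"
    using eq1 eq2 eventually_at_right_less
  proof eventually_elim
    case (elim \<epsilon>)
    have D: "D \<epsilon> = 1 + \<epsilon>\<^sup>2 * s \<epsilon>"
      by (simp add: D_def s_def)
    have u1: "c1 * u \<epsilon> = c1 * u0 * D \<epsilon> - \<epsilon> * (v \<epsilon> * l \<epsilon>) / 2"
      using elim(1) D_pos[of \<epsilon>] by (simp add: divide_eq_eq)
    have v1: "c2 * v \<epsilon> = c2 * v0 * D \<epsilon> + \<epsilon> * (u \<epsilon> * l \<epsilon>) / 2"
      using elim(2) D_pos[of \<epsilon>] by (simp add: divide_eq_eq)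
    have ru: "u \<epsilon> = u0 + \<epsilon> * ru \<epsilon>"
    proof -
      have "u \<epsilon> = (c1 * u0 * D \<epsilon> - \<epsilon> * (v \<epsilon> * l \<epsilon>) / 2) / c1"
        using u1 assms(1) by (simp add: eq_divide_eq mult.commute)
      then show ?thesis
        using assms(1) by (simp add: ru_def D field_simps power2_eq_square)
    qed
    have rv: "v \<epsilon> = v0 + \<epsilon> * rv \<epsilon>"
    proof -
      have "v \<epsilon> = (c2 * v0 * D \<epsilon> + \<epsilon> * (u \<epsilon> * l \<epsilon>) / 2) / c2"
        using v1 assms(2) by (simp add: eq_divide_eq mult.commute)
      then show ?thesis
        using assms(2) by (simp add: rv_def D field_simps power2_eq_square)
    qed
    have rl: "l \<epsilon> = l0 + \<epsilon> * rl \<epsilon>"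
      unfolding l_def l0_def rl_def by (subst ru, subst rv) (simp add: algebra_simps)
    have vl: "v \<epsilon> * l \<epsilon> = v0 * l0 + \<epsilon> * (rv \<epsilon> * l \<epsilon> + v0 * rl \<epsilon>)"
      using rv rl by algebra
    have ul: "u \<epsilon> * l \<epsilon> = u0 * l0 + \<epsilon> * (ru \<epsilon> * l \<epsilon> + u0 * rl \<epsilon>)"
      using ru rl by algebra
    have ru2: "ru \<epsilon> = - (v0 * l0) / c1 / 2 + \<epsilon> * ru2 \<epsilon>"
      unfolding ru_def ru2_def vl using assms(1) by (simp add: field_simps)
    have rv2: "rv \<epsilon> = u0 * l0 / c2 / 2 + \<epsilon> * rv2 \<epsilon>"
      unfolding rv_def rv2_def ul using assms(2) by (simp add: field_simps)
    \<comment> \<open>The velocity of the flow at \<open>(u0, v0)\<close>; by \<open>ru2\<close> and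
      \<open>rv2\<close> half of it is the first order term of \<open>u\<close> and
      \<open>v\<close>.\<close>
    define x' y' where "x' = - (v0 * l0) / c1" and "y' = u0 * l0 / c2"
    have vl2: "v \<epsilon> * l \<epsilon> = v0 * l0 + \<epsilon> / 2 * (y' * l0 + v0 * (\<alpha> * x' + \<beta> * y'))
        + \<epsilon>\<^sup>2 * (rv2 \<epsilon> * l0 + v0 * (\<alpha> * ru2 \<epsilon> + \<beta> * rv2 \<epsilon>) + rv \<epsilon> * rl \<epsilon>)"
    proof -
      have "v \<epsilon> * l \<epsilon> = v0 * l0 + \<epsilon> * (rv \<epsilon> * l0 + v0 * rl \<epsilon>) + \<epsilon>\<^sup>2 * (rv \<epsilon> * rl \<epsilon>)"
        using vl rl by algebra
      also have "rv \<epsilon> * l0 + v0 * rl \<epsilon> = (y' * l0 + v0 * (\<alpha> * x' + \<beta> * y')) / 2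
          + \<epsilon> * (rv2 \<epsilon> * l0 + v0 * (\<alpha> * ru2 \<epsilon> + \<beta> * rv2 \<epsilon>))"
        unfolding rl_def ru2[folded x'_def] rv2[folded y'_def] by (simp add: algebra_simps add_divide_distrib)
      finally show ?thesis by (simp add: algebra_simps power2_eq_square)
    qed
    \<comment> \<open>Inserting \<open>u1\<close> doubles the quadratic term and cancels
      \<open>D\<close> against \<open>c1 * u0\<close>. As \<open>D\<close> differs from 1 by
      \<open>\<epsilon>\<^sup>2 * s \<epsilon>\<close> and now divides a term of order
      \<open>\<epsilon>\<close>, it contributes at third order only.\<close>
    have "(c1 * u \<epsilon> - \<epsilon> * (v \<epsilon> * l \<epsilon>) / 2) / D \<epsilon> = c1 * u0 - \<epsilon> * (v \<epsilon> * l \<epsilon>) / D \<epsilon>"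
      unfolding u1 using D_pos[of \<epsilon>] by (simp add: field_simps)
    also have "\<dots> = c1 * u0 - \<epsilon> * (v \<epsilon> * l \<epsilon>) + \<epsilon> ^ 3 * (s \<epsilon> * v \<epsilon> * l \<epsilon> / D \<epsilon>)"
      using D_pos[of \<epsilon>] by (simp add: divide_simps) (simp add: D algebra_simps power2_eq_square power3_eq_cube)
    finally show ?case
      unfolding vl2 R_def x'_def[symmetric] y'_def[symmetric]
      by (simp add: algebra_simps power2_eq_square power3_eq_cube)
  qed
  have "((\<lambda>\<epsilon>. \<epsilon> ^ 3 * R \<epsilon> / \<epsilon> ^ 3) \<longlongrightarrow> c) (at_right 0)"
    using R by (rule Lim_transform_eventually) (auto simp: eventually_at_filter)
  then have "(\<lambda>\<epsilon>. \<epsilon> ^ 3 * R \<epsilon>) \<in> O[at_right 0](\<lambda>\<epsilon>. \<epsilon> ^ 3)"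
    by (rule bigoI_tendsto) (auto simp: eventually_at_filter)
  then show ?thesis
    using landau_o.big.in_cong[OF eq] by blast
qed

lemma step_error:
  fixes x y u v :: "real \<Rightarrow> real" and c1 c2 \<alpha> \<beta> :: real
  assumes "0 < T" "c1 \<noteq> 0" "c2 \<noteq> 0"
    and "\<And>t. t \<in> {0..T} \<Longrightarrow>
      (x has_real_derivative - (y t * (\<alpha> * x t + \<beta> * y t)) / c1) (at t within {0..T})"
    and "\<And>t. t \<in> {0..T} \<Longrightarrow>
      (y has_real_derivative x t * (\<alpha> * x t + \<beta> * y t) / c2) (at t within {0..T})"
    and "(u \<longlongrightarrow> x 0) (at_right 0)" "(v \<longlongrightarrow> y 0) (at_right 0)"
    and "\<forall>\<^sub>F \<epsilon> in at_right 0. (c1 * u \<epsilon> + \<epsilon> * (v \<epsilon> * (\<alpha> * u \<epsilon> + \<beta> * v \<epsilon>)) / 2) /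
      (1 + \<epsilon>\<^sup>2 * ((u \<epsilon>)\<^sup>2 + (v \<epsilon>)\<^sup>2) / 4) = c1 * x 0"
    and "\<forall>\<^sub>F \<epsilon> in at_right 0. (c2 * v \<epsilon> - \<epsilon> * (u \<epsilon> * (\<alpha> * u \<epsilon> + \<beta> * v \<epsilon>)) / 2) /
      (1 + \<epsilon>\<^sup>2 * ((u \<epsilon>)\<^sup>2 + (v \<epsilon>)\<^sup>2) / 4) = c2 * y 0"
  shows "(\<lambda>\<epsilon>. (c1 * u \<epsilon> - \<epsilon> * (v \<epsilon> * (\<alpha> * u \<epsilon> + \<beta> * v \<epsilon>)) / 2) /
      (1 + \<epsilon>\<^sup>2 * ((u \<epsilon>)\<^sup>2 + (v \<epsilon>)\<^sup>2) / 4) - c1 * x \<epsilon>) \<in> O[at_right 0](\<lambda>\<epsilon>. \<epsilon> ^ 3)"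
  using sum_in_bigo(2)[OF step_expansion[OF assms(2,3,6-9)] flow_expansion[OF assms(1-5)]]
  by simp

section \<open>The projected momentum map and the error estimate\<close>

text \<open>At \<open>\<epsilon> = 0\<close> the left side is 0 by convention while the right side
  is \<open>(I$1$1 * u, I$2$2 * v)\<close>, hence the assumption.\<close>

lemma momentum_uv_components:
  assumes "\<epsilon> \<noteq> 0"
  shows "momentum_uv I \<epsilon> (u, v) =
    ((I$1$1 * u + \<epsilon> * (v * (I$1$3 * u + I$2$3 * v)) / 2) / (1 + \<epsilon>\<^sup>2 * (u\<^sup>2 + v\<^sup>2) / 4),
     (I$2$2 * v - \<epsilon> * (u * (I$1$3 * u + I$2$3 * v)) / 2) / (1 + \<epsilon>\<^sup>2 * (u\<^sup>2 + v\<^sup>2) / 4))"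
proof -
  have D: "1 + ((\<epsilon> * u)\<^sup>2 + (\<epsilon> * v)\<^sup>2) / 4 = 1 + \<epsilon>\<^sup>2 * (u\<^sup>2 + v\<^sup>2) / 4"
    by (simp add: power_mult_distrib distrib_left)
  have "(1/\<epsilon>) * (n / d) = m / d" if "n = \<epsilon> * m" for n m d :: real
    using assms that by simp
  note cancel = this
  show ?thesis
    unfolding momentum_uv_eq scaled_momentum_def scaleR_Pair fst_conv snd_conv real_scaleR_def D prod.inject
    by (intro conjI cancel) (simp_all add: algebra_simps add_divide_distrib diff_divide_distrib)
qed

text \<open>The linear terms are odd and the quadratic terms and the denominator are even, so the
  two negations together flip only the quadratic terms.\<close>

lemma momentum_uv_reflected_components:
  assumes "\<epsilon> \<noteq> 0"
  shows "- momentum_uv I \<epsilon> (- (u, v)) =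
    ((I$1$1 * u - \<epsilon> * (v * (I$1$3 * u + I$2$3 * v)) / 2) / (1 + \<epsilon>\<^sup>2 * (u\<^sup>2 + v\<^sup>2) / 4),
     (I$2$2 * v + \<epsilon> * (u * (I$1$3 * u + I$2$3 * v)) / 2) / (1 + \<epsilon>\<^sup>2 * (u\<^sup>2 + v\<^sup>2) / 4))"
proof -
  have neg: "- (n / d) = m / d" if "m = - n" for n m d :: real
    using that by simp
  show ?thesis
    unfolding uminus_Pair momentum_uv_components[OF assms] power2_minus prod.inject
    by (intro conjI neg) (simp_all add: algebra_simps)
qed

text \<open>\<open>suslov_step_iff\<close> determines the momentum after a step for any branch,
  provided \<open>P \<epsilon> m\<close> lies in the domain \<open>W\<close> of \<open>B\<close>.
  Since \<open>P \<epsilon> m\<close> converges, this holds for small \<open>\<epsilon>\<close> once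
  the limit lies in the open set \<open>W\<close>; \<open>U\<close> consists of such
  \<open>m\<close>, with a threshold for \<open>\<epsilon>\<close> depending on
  \<open>m\<close>.\<close>

lemma projected_momentum_map_eq:
  assumes "suslov_branch I B" "legendre_inverse I P"
  obtains U where "open U" "(0, 0) \<in> U"
    "\<And>m. m \<in> U \<Longrightarrow> ((\<lambda>\<epsilon>. P \<epsilon> m) \<longlongrightarrow> (fst m / I$1$1, snd m / I$2$2)) (at_right 0)"
    "\<And>m. m \<in> U \<Longrightarrow> \<forall>\<^sub>F \<epsilon> in at_right 0. momentum_uv I \<epsilon> (P \<epsilon> m) = m"
    "\<And>m. m \<in> U \<Longrightarrow> \<forall>\<^sub>F \<epsilon> in at_right 0.
      projected_momentum_map I B P \<epsilon> m = - momentum_uv I \<epsilon> (- P \<epsilon> m)"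
proof -
  obtain W \<epsilon>1 where W: "open W" "(0, 0) \<in> W" "0 < \<epsilon>1"
    "\<And>\<epsilon> p. \<epsilon> \<in> {0<..<\<epsilon>1} \<Longrightarrow> p \<in> W \<Longrightarrow> suslov_step I \<epsilon> (cay_uv \<epsilon> p) (cay_uv \<epsilon> (B \<epsilon> p))"
    using assms(1) unfolding suslov_branch_def by blast
  obtain V \<epsilon>2 where V: "open V" "(0, 0) \<in> V" "0 < \<epsilon>2"
    "\<And>\<epsilon> m. \<epsilon> \<in> {0<..<\<epsilon>2} \<Longrightarrow> m \<in> V \<Longrightarrow> momentum_uv I \<epsilon> (P \<epsilon> m) = m"
    "\<And>m. m \<in> V \<Longrightarrow> ((\<lambda>\<epsilon>. P \<epsilon> m) \<longlongrightarrow> (fst m / I$1$1, snd m / I$2$2)) (at_right 0)"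
    using assms(2) unfolding legendre_inverse_def by blast
  define q where "q m = (fst m / I$1$1, snd m / I$2$2)" for m :: "real \<times> real"
  have "continuous_on UNIV q"
    unfolding q_def divide_inverse by (intro continuous_intros)
  with W(1) have "open (q -` W)"
    by (rule open_vimage)
  show thesis
  proof
    show "open (V \<inter> q -` W)"
      using V(1) \<open>open (q -` W)\<close> by blast
    show "(0, 0) \<in> V \<inter> q -` W"
      using V(2) W(2) by (simp add: q_def)
    fix m assume m: "m \<in> V \<inter> q -` W"
    then show lim: "((\<lambda>\<epsilon>. P \<epsilon> m) \<longlongrightarrow> (fst m / I$1$1, snd m / I$2$2)) (at_right 0)"
      using V(5) by blast
    show "\<forall>\<^sub>F \<epsilon> in at_right 0. momentum_uv I \<epsilon> (P \<epsilon> m) = m"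
      using eventually_at_right_real[OF V(3)] by eventually_elim (use V(4) m in blast)
    have "\<forall>\<^sub>F \<epsilon> in at_right 0. P \<epsilon> m \<in> W"
      using lim W(1) m by (intro topological_tendstoD) (auto simp: q_def)
    then show "\<forall>\<^sub>F \<epsilon> in at_right 0.
      projected_momentum_map I B P \<epsilon> m = - momentum_uv I \<epsilon> (- P \<epsilon> m)"
      using eventually_at_right_real[OF W(3)]
    proof eventually_elim
      case (elim \<epsilon>)
      then show ?case
        using W(4)[of \<epsilon> "P \<epsilon> m"] by (simp add: suslov_step_iff projected_momentum_map_def)
    qed
  qed
qed

theorem theorem5p1:
  fixes I :: "real^3^3"
  assumes "inertia_tensor I" and "I $ 1 $ 2 = 0"
  shows "(\<exists>B. suslov_branch I B) \<and> (\<exists>P. legendre_inverse I P) \<and>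
    (\<forall>B P. suslov_branch I B \<longrightarrow> legendre_inverse I P \<longrightarrow>
      (\<exists>U. open U \<and> (0,0) \<in> U \<and>
        (\<forall>a b T M1 M2. (a, b) \<in> U \<longrightarrow> 0 < T \<longrightarrow> reduced_solution I T M1 M2 \<longrightarrow>
           M1 0 = a \<longrightarrow> M2 0 = b \<longrightarrow>
           (\<lambda>\<epsilon>. fst (projected_momentum_map I B P \<epsilon> (a, b)) - M1 \<epsilon>) \<in> O[at_right 0](\<lambda>\<epsilon>. \<epsilon> ^ 3) \<and>
           (\<lambda>\<epsilon>. snd (projected_momentum_map I B P \<epsilon> (a, b)) - M2 \<epsilon>) \<in> O[at_right 0](\<lambda>\<epsilon>. \<epsilon> ^ 3))))"
proof -
  define c1 c2 \<alpha> \<beta> where "c1 = I$1$1" and "c2 = I$2$2" and "\<alpha> = I$1$3" and "\<beta> = I$2$3"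
  note cs = c1_def[symmetric] c2_def[symmetric] \<alpha>_def[symmetric] \<beta>_def[symmetric]
  have c: "c1 \<noteq> 0" "c2 \<noteq> 0"
    using inertia_tensor_diag_pos[OF assms(1)] unfolding c1_def c2_def by (metis less_irrefl)+
  have "\<exists>U. open U \<and> (0,0) \<in> U \<and>
        (\<forall>a b T M1 M2. (a, b) \<in> U \<longrightarrow> 0 < T \<longrightarrow> reduced_solution I T M1 M2 \<longrightarrow>
           M1 0 = a \<longrightarrow> M2 0 = b \<longrightarrow>
           (\<lambda>\<epsilon>. fst (projected_momentum_map I B P \<epsilon> (a, b)) - M1 \<epsilon>) \<in> O[at_right 0](\<lambda>\<epsilon>. \<epsilon> ^ 3) \<and>
           (\<lambda>\<epsilon>. snd (projected_momentum_map I B P \<epsilon> (a, b)) - M2 \<epsilon>) \<in> O[at_right 0](\<lambda>\<epsilon>. \<epsilon> ^ 3))"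
    if BP: "suslov_branch I B" "legendre_inverse I P" for B P
  proof -
    obtain U where U: "open U" "(0, 0) \<in> U"
      "\<And>m. m \<in> U \<Longrightarrow> ((\<lambda>\<epsilon>. P \<epsilon> m) \<longlongrightarrow> (fst m / c1, snd m / c2)) (at_right 0)"
      "\<And>m. m \<in> U \<Longrightarrow> \<forall>\<^sub>F \<epsilon> in at_right 0. momentum_uv I \<epsilon> (P \<epsilon> m) = m"
      "\<And>m. m \<in> U \<Longrightarrow> \<forall>\<^sub>F \<epsilon> in at_right 0.
        projected_momentum_map I B P \<epsilon> m = - momentum_uv I \<epsilon> (- P \<epsilon> m)"
      using projected_momentum_map_eq[OF BP, unfolded cs] by blast
    have "(\<lambda>\<epsilon>. fst (projected_momentum_map I B P \<epsilon> (a, b)) - M1 \<epsilon>) \<in> O[at_right 0](\<lambda>\<epsilon>. \<epsilon> ^ 3) \<and>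
          (\<lambda>\<epsilon>. snd (projected_momentum_map I B P \<epsilon> (a, b)) - M2 \<epsilon>) \<in> O[at_right 0](\<lambda>\<epsilon>. \<epsilon> ^ 3)"
      if m: "(a, b) \<in> U" and T: "0 < T" and sol: "reduced_solution I T M1 M2"
        and init: "M1 0 = a" "M2 0 = b" for a b T M1 M2
    proof -
      \<comment> \<open>In these variables the initial point \<open>(x 0, y 0)\<close> is the
        prescribed limit of \<open>P \<epsilon> (a, b)\<close>, so flow and step are expanded about
        the same point.\<close>
      define x y where "x t = M1 t / c1" and "y t = M2 t / c2" for t
      have M: "M1 = (\<lambda>t. c1 * x t)" "M2 = (\<lambda>t. c2 * y t)"
        using c by (simp_all add: x_def y_def)
      have x: "(x has_real_derivative - (y t * (\<alpha> * x t + \<beta> * y t)) / c1) (at t within {0..T})"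
        and y: "(y has_real_derivative x t * (\<alpha> * x t + \<beta> * y t) / c2) (at t within {0..T})"
        if "t \<in> {0..T}" for t
      proof -
        have "(M1 has_real_derivative - (y t * (\<alpha> * x t + \<beta> * y t))) (at t within {0..T})"
          "(M2 has_real_derivative x t * (\<alpha> * x t + \<beta> * y t)) (at t within {0..T})"
          using sol that c unfolding reduced_solution_def cs
          by (auto simp: x_def y_def field_simps power2_eq_square)
        from DERIV_cdivide[OF this(1), of c1] DERIV_cdivide[OF this(2), of c2]
        show "(x has_real_derivative - (y t * (\<alpha> * x t + \<beta> * y t)) / c1) (at t within {0..T})"
          "(y has_real_derivative x t * (\<alpha> * x t + \<beta> * y t) / c2) (at t within {0..T})"
          by (simp_all add: x_def[abs_def] y_def[abs_def])
      qed
      define u v where "u \<epsilon> = fst (P \<epsilon> (a, b))" and "v \<epsilon> = snd (P \<epsilon> (a, b))" for \<epsilon>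
      have P: "P \<epsilon> (a, b) = (u \<epsilon>, v \<epsilon>)" for \<epsilon>
        by (simp add: u_def v_def)
      have u: "(u \<longlongrightarrow> x 0) (at_right 0)" and v: "(v \<longlongrightarrow> y 0) (at_right 0)"
        using tendsto_fst[OF U(3)[OF m]] tendsto_snd[OF U(3)[OF m]] init
        by (simp_all add: u_def[abs_def] v_def[abs_def] x_def y_def)
      have mom: "\<forall>\<^sub>F \<epsilon> in at_right 0. momentum_uv I \<epsilon> (u \<epsilon>, v \<epsilon>) = (c1 * x 0, c2 * y 0) \<and> 0 < \<epsilon>"
        using U(4)[OF m] eventually_at_right_less[of 0] by eventually_elim (use init M P in simp)
      let ?l = "\<lambda>\<epsilon>. \<alpha> * u \<epsilon> + \<beta> * v \<epsilon>" and ?D = "\<lambda>\<epsilon>. 1 + \<epsilon>\<^sup>2 * ((u \<epsilon>)\<^sup>2 + (v \<epsilon>)\<^sup>2) / 4"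
      have "\<forall>\<^sub>F \<epsilon> in at_right 0. (c1 * u \<epsilon> + \<epsilon> * (v \<epsilon> * ?l \<epsilon>) / 2) / ?D \<epsilon> = c1 * x 0 \<and>
          (c2 * v \<epsilon> - \<epsilon> * (u \<epsilon> * ?l \<epsilon>) / 2) / ?D \<epsilon> = c2 * y 0"
        using mom
      proof eventually_elim
        case (elim \<epsilon>)
        then have "\<epsilon> \<noteq> 0"
          by simp
        from elim show ?case
          unfolding momentum_uv_components[OF \<open>\<epsilon> \<noteq> 0\<close>] cs prod.inject by blast
      qed
      then have eqs: "\<forall>\<^sub>F \<epsilon> in at_right 0. (c1 * u \<epsilon> + \<epsilon> * (v \<epsilon> * ?l \<epsilon>) / 2) / ?D \<epsilon> = c1 * x 0"
        "\<forall>\<^sub>F \<epsilon> in at_right 0. (c2 * v \<epsilon> - \<epsilon> * (u \<epsilon> * ?l \<epsilon>) / 2) / ?D \<epsilon> = c2 * y 0"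
        unfolding eventually_conj_iff by blast+
      have proj: "\<forall>\<^sub>F \<epsilon> in at_right 0. projected_momentum_map I B P \<epsilon> (a, b) =
          ((c1 * u \<epsilon> - \<epsilon> * (v \<epsilon> * ?l \<epsilon>) / 2) / ?D \<epsilon>, (c2 * v \<epsilon> + \<epsilon> * (u \<epsilon> * ?l \<epsilon>) / 2) / ?D \<epsilon>)"
        using U(5)[OF m] eventually_at_right_less[of 0]
      proof eventually_elim
        case (elim \<epsilon>)
        then have "\<epsilon> \<noteq> 0"
          by simp
        show ?case
          unfolding elim(1) P momentum_uv_reflected_components[OF \<open>\<epsilon> \<noteq> 0\<close>] cs ..
      qed
      have 1: "(\<lambda>\<epsilon>. (c1 * u \<epsilon> - \<epsilon> * (v \<epsilon> * ?l \<epsilon>) / 2) / ?D \<epsilon> - c1 * x \<epsilon>) \<in> O[at_right 0](\<lambda>\<epsilon>. \<epsilon> ^ 3)"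
        by (rule step_error[OF T c x y u v eqs])
      have 2: "(\<lambda>\<epsilon>. (c2 * v \<epsilon> + \<epsilon> * (u \<epsilon> * ?l \<epsilon>) / 2) / ?D \<epsilon> - c2 * y \<epsilon>) \<in> O[at_right 0](\<lambda>\<epsilon>. \<epsilon> ^ 3)"
      proof -
        \<comment> \<open>Exchanging the two coordinates and replacing \<open>(\<alpha>, \<beta>)\<close> by \<open>(- \<beta>, - \<alpha>)\<close> is a symmetry
          of both the flow and the discrete map.\<close>
        have swap: "- \<beta> * q + - \<alpha> * p = - (\<alpha> * p + \<beta> * q)"
          "p * - q = - (p * q)" "- (- p) = p" "p + - q / 2 = p - q / 2" "p - - q / 2 = p + q / 2" for p q
          by simp_all
        \<comment> \<open>Exchanging the coordinates also reverses the sum of squares in the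
          denominator.\<close>
        have comm: "(u \<epsilon>)\<^sup>2 + (v \<epsilon>)\<^sup>2 = (v \<epsilon>)\<^sup>2 + (u \<epsilon>)\<^sup>2" for \<epsilon>
          by (rule add.commute)
        note eqs' = eqs[unfolded comm]
        show ?thesis
          unfolding comm
          by (rule step_error[of T c2 c1 y x "- \<beta>" "- \<alpha>" v u, unfolded swap, OF T c(2,1) y x v u eqs'(2,1)])
      qed
      have "(\<lambda>\<epsilon>. fst (projected_momentum_map I B P \<epsilon> (a, b)) - M1 \<epsilon>) \<in> O[at_right 0](\<lambda>\<epsilon>. \<epsilon> ^ 3)"
        by (rule iffD2[OF landau_o.big.in_cong 1], rule eventually_mono[OF proj]) (simp add: M)
      moreover have "(\<lambda>\<epsilon>. snd (projected_momentum_map I B P \<epsilon> (a, b)) - M2 \<epsilon>) \<in> O[at_right 0](\<lambda>\<epsilon>. \<epsilon> ^ 3)"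
        by (rule iffD2[OF landau_o.big.in_cong 2], rule eventually_mono[OF proj]) (simp add: M)
      ultimately show ?thesis ..
    qed
    then show ?thesis
      using U(1,2) by blast
  qed
  then show ?thesis
    using suslov_branch_exists[of I] legendre_inverse_exists[of I] c unfolding c1_def c2_def by blast
qed

end
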